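(* Let $q\ge \frac{12}{11}$ and let $g\in L^2(0,1)$. For all $N\in\mathbb{N}$, \[ \|g-g^*_{N}\| \leq \frac{\|T_q^{-1}\|\,\pi_q}{2\sqrt{2}}\, \Big\|g-\sum_{n=1}^N \widehat{g}(n) e_n \Big\|, \] where $g_N^*=\sum_{j=1}^N\langle g,f_j\rangle f_j^*$ is the $N$-term expansion of $g$ in the dual $q$-sine basis.
   Context: $\langle\cdot,\cdot\rangle$ and $\|\cdot\|$ denote the inner product and norm of (real) $L^2(0,1)$; for operators $\|\cdot\|$ is the operator norm on $L^2(0,1)$. $\mathbb{N}=\{1,2,\dots\}$. For $z\in\mathbb{R}$ and $a>0$ write $\llbracket z\rrbracket^{a}=z|z|^{a-1}$ (equal to $0$ at $z=0$). Let $q>1$ and $\pi_q=\frac{2\pi}{q\sin(\pi/q)}$. Consider the eigenvalue problem $-(\llbracket u'\rrbracket^{q-1})'=(q-1)\lambda\llbracket u\rrbracket^{q-1}$ on $0\le x\le 1$, $u(0)=u(1)=0$. Its eigenvalues are $\lambda=(n\pi_q)^q$, $n\in\mathbb{N}$. The $q$-sine functions $f_n$ are the eigenfunctions associated with $(n\pi_q)^q$, normalized by $f_n'(0)=n\pi_q$. The function $f_1$ is strictly increasing on $[0,1/2]$, decreasing on $[1/2,1]$, even with respect to $x=1/2$, satisfies $|f_1(x)|^q+\pi_q^{-q}|f_1'(x)|^q=1$, and is extended to $\mathbb{R}$ as an odd 2-periodic $C^1$ function; then $f_n(x)=f_1(nx)$. Let $e_n(x)=\sqrt2\sin(n\pi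 x)$, an orthonormal basis of $L^2(0,1)$, and $\widehat g(n)=\langle g,e_n\rangle$. For $q\ge \frac{12}{11}$ it is known (from earlier work) that the Schauder transform $T_q:L^2(0,1)\to L^2(0,1)$, the linear extension of $e_n\mapsto f_n$, is a bounded invertible operator, so $\{f_n\}_{n\in\mathbb{N}}$ is a Riesz basis of $L^2(0,1)$. The dual basis $\{f_n^*\}_{n\in\mathbb{N}}$ is determined by $\langle f_j,f_k^*\rangle=\delta_{jk}$, i.e. $f_n^*=(T_q^{-1})^*e_n$. *)

theory Defs
  imports "HOL-Analysis.Analysis"
begin

abbreviation unit_measure :: "real measure"
  where "unit_measure \<equiv> lebesgue_on {0<..<1}"

definition square_integrable :: "(real \<Rightarrow> real) \<Rightarrow> bool"
  where "square_integrable f \<longleftrightarrow>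
    f \<in> borel_measurable unit_measure \<and> integrable unit_measure (\<lambda>x. (f x)\<^sup>2)"

lemma square_integrable_zero [simp]: "square_integrable (\<lambda>x. 0)"
  by (simp add: square_integrable_def)

lemma square_integrable_mult:
  assumes "square_integrable f" "square_integrable g"
  shows "integrable unit_measure (\<lambda>x. f x * g x)"
proof (rule Bochner_Integration.integrable_bound)
  show "integrable unit_measure (\<lambda>x. (f x)\<^sup>2 + (g x)\<^sup>2)"
    using assms by (simp add: square_integrable_def)
  show "(\<lambda>x. f x * g x) \<in> borel_measurable unit_measure"
    using assms by (intro borel_measurable_times) (simp_all add: square_integrable_def)
  have "\<bar>a * b\<bar> \<le> a\<^sup>2 + b\<^sup>2" for a b :: real
  proof -
    have "2 * (\<bar>a\<bar> * \<bar>b\<bar>) \<le> a\<^sup>2 + b\<^sup>2"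
      using sum_squares_bound[of "\<bar>a\<bar>" "\<bar>b\<bar>"] by (simp add: mult.assoc)
    moreover have "0 \<le> \<bar>a\<bar> * \<bar>b\<bar>" by simp
    ultimately show ?thesis unfolding abs_mult by linarith
  qed
  then show "AE x in unit_measure. norm (f x * g x) \<le> norm ((f x)\<^sup>2 + (g x)\<^sup>2)"
    by (intro AE_I2) (metis abs_ge_self order_trans real_norm_def)
qed

lemma square_integrable_add:
  assumes "square_integrable f" "square_integrable g"
  shows "square_integrable (\<lambda>x. f x + g x)"
  using assms square_integrable_mult[OF assms]
  by (auto simp: square_integrable_def power2_sum mult.assoc)

lemma square_integrable_scale:
  assumes "square_integrable f"
  shows "square_integrable (\<lambda>x. c * f x)"
  using assms by (auto simp: square_integrable_def power_mult_distrib)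

definition ae_equal :: "(real \<Rightarrow> real) \<Rightarrow> (real \<Rightarrow> real) \<Rightarrow> bool"
  where "ae_equal f g \<longleftrightarrow>
    square_integrable f \<and> square_integrable g \<and> (AE x in unit_measure. f x = g x)"

quotient_type L2 = "real \<Rightarrow> real" / partial: ae_equal
proof (rule part_equivpI)
  show "\<exists>f. ae_equal f f"
    by (intro exI[of _ "\<lambda>x. 0"]) (simp add: ae_equal_def)
  show "symp ae_equal"
    by (auto simp: symp_def ae_equal_def)
  show "transp ae_equal"
    unfolding transp_def ae_equal_def by (auto elim: AE_mp)
qed

instantiation L2 :: real_vector
begin

lift_definition zero_L2 :: L2 is "\<lambda>x. 0"
  by (simp add: ae_equal_def)

lift_definition plus_L2 :: "L2 \<Rightarrow> L2 \<Rightarrow> L2" is "\<lambda>f g x. f x + g x"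
  unfolding ae_equal_def by (auto intro: square_integrable_add)

lift_definition scaleR_L2 :: "real \<Rightarrow> L2 \<Rightarrow> L2" is "\<lambda>c f x. c * f x"
  unfolding ae_equal_def by (auto intro: square_integrable_scale)

definition uminus_L2 :: "L2 \<Rightarrow> L2"
  where "uminus_L2 f = (-1) *\<^sub>R f"

definition minus_L2 :: "L2 \<Rightarrow> L2 \<Rightarrow> L2"
  where "minus_L2 f g = f + - g"

instance
proof
  fix f g h :: L2 and a b :: real
  show "f + g + h = f + (g + h)"
    by transfer (auto simp: ae_equal_def add.assoc intro!: square_integrable_add)
  show "f + g = g + f"
    by transfer (auto simp: ae_equal_def add.commute intro!: square_integrable_add)
  show "0 + f = f"
    by transfer (auto simp: ae_equal_def)
  show "- f + f = 0"
    unfolding uminus_L2_def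
    by transfer (auto simp: ae_equal_def)
  show "f - g = f + - g"
    by (rule minus_L2_def)
  show "a *\<^sub>R (f + g) = a *\<^sub>R f + a *\<^sub>R g"
    by transfer (auto simp: ae_equal_def distrib_left
      intro!: square_integrable_add square_integrable_scale)
  show "(a + b) *\<^sub>R f = a *\<^sub>R f + b *\<^sub>R f"
    by transfer (auto simp: ae_equal_def distrib_right
      intro!: square_integrable_add square_integrable_scale)
  show "a *\<^sub>R b *\<^sub>R f = (a * b) *\<^sub>R f"
    by transfer (auto simp: ae_equal_def mult.assoc intro!: square_integrable_scale)
  show "1 *\<^sub>R f = f"
    by transfer (auto simp: ae_equal_def)
qed

end

instantiation L2 :: real_inner
begin

lift_definition inner_L2 :: "L2 \<Rightarrow> L2 \<Rightarrow> real"
  is "\<lambda>f g. integral\<^sup>L unit_measure (\<lambda>x. f x * g x)"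
  unfolding ae_equal_def square_integrable_def
  by (intro integral_cong_AE) auto

definition norm_L2 :: "L2 \<Rightarrow> real"
  where "norm_L2 f = sqrt (inner f f)"

definition sgn_L2 :: "L2 \<Rightarrow> L2"
  where "sgn_L2 f = f /\<^sub>R norm f"

definition dist_L2 :: "L2 \<Rightarrow> L2 \<Rightarrow> real"
  where "dist_L2 f g = norm (f - g)"

definition uniformity_L2 :: "(L2 \<times> L2) filter"
  where "uniformity_L2 = (INF e\<in>{0<..}. principal {(x, y). dist x y < e})"

definition open_L2 :: "L2 set \<Rightarrow> bool"
  where "open_L2 U = (\<forall>x\<in>U. eventually (\<lambda>(x', y). x' = x \<longrightarrow> y \<in> U) uniformity)"

instance
proof
  fix f g h :: L2 and a :: real
  show "inner f g = inner g f"
    by transfer (simp add: mult.commute)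
  show "inner (f + g) h = inner f h + inner g h"
    by transfer
      (auto simp: ae_equal_def distrib_right square_integrable_mult)
  show "inner (a *\<^sub>R f) g = a * inner f g"
    by transfer (simp add: mult.assoc)
  show "0 \<le> inner f f"
    by transfer (simp add: integral_nonneg_AE)
  show "inner f f = 0 \<longleftrightarrow> f = 0"
    by transfer (simp add: ae_equal_def integral_nonneg_eq_0_iff_AE square_integrable_mult)
qed (rule norm_L2_def sgn_L2_def dist_L2_def uniformity_L2_def open_L2_def)+

end

(* A function that is not square integrable is sent to 0. *)
lift_definition to_L2 :: "(real \<Rightarrow> real) \<Rightarrow> L2"
  is "\<lambda>f. if square_integrable f then f else (\<lambda>x. 0)"
  by (auto simp: ae_equal_def)

definition sine_basis :: "nat \<Rightarrow> L2"
  where "sine_basis n = to_L2 (\<lambda>x. sqrt 2 * sin (real n * pi * x))"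

definition signed_powr :: "real \<Rightarrow> real \<Rightarrow> real"
  where "signed_powr z a = z * \<bar>z\<bar> powr (a - 1)"

definition pi_q :: "real \<Rightarrow> real"
  where "pi_q q = 2 * pi / (q * sin (pi / q))"

(* u' is the derivative of u on the closed interval (one-sided at the end points). Its
   continuity need not be required: the second derivative clause makes signed_powr u' (q - 1)
   continuous, and z \<mapsto> signed_powr z (q - 1) is a homeomorphism for q > 1. *)
definition q_laplace_solution ::
    "real \<Rightarrow> real \<Rightarrow> (real \<Rightarrow> real) \<Rightarrow> (real \<Rightarrow> real) \<Rightarrow> bool"
  where "q_laplace_solution q lam u u' \<longleftrightarrow>
    (\<forall>x\<in>{0..1}. (u has_real_derivative u' x) (at x within {0..1})) \<and>
    (\<forall>x\<in>{0..1}. ((\<lambda>t. signed_powr (u' t) (q - 1)) has_real_derivative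
        - ((q - 1) * lam * signed_powr (u x) (q - 1))) (at x within {0..1})) \<and>
    u 0 = 0 \<and> u 1 = 0"

(* Only the values on [0, 1] are constrained; for n > 0 and q > 1 the normalisation at 0
   excludes the zero solution and determines u on [0, 1]. *)
definition q_sine :: "real \<Rightarrow> nat \<Rightarrow> (real \<Rightarrow> real) \<Rightarrow> bool"
  where "q_sine q n u \<longleftrightarrow>
    (\<exists>u'. q_laplace_solution q ((real n * pi_q q) powr q) u u' \<and> u' 0 = real n * pi_q q)"

end

theory Submission imports Defs begin

text \<open>
  Write a k for the sine coefficients of f 1. Since f n (x) = f 1 (n x), one has
  f n = sum over k of a k * e (k n). Let R be the left-hand remainder and h = inv T R. Then R is
  orthogonal to f n for n <= N and has the same inner product with f n as g for n > N, so
  |R|^2 = <R, T h> is the sum over n > N of <h, e n> <g, f n>. Exchanging the two sums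
  and using the inequalities of Cauchy-Schwarz and Bessel for each k bounds this by
  (sum of |a k|) * |h| * |g - P g|, with P the projection onto the first N sines.

  It remains to see that the sum of |a k| is at most pi_q / (2 sqrt 2). The even coefficients
  vanish because f 1 is symmetric about 1/2; integration by parts gives
  k pi a k = <f 1', sqrt 2 cos (k pi x)>; Cauchy-Schwarz, Bessel, the bound |f 1'| <= pi_q and
  the value pi^2 / 8 of the sum of 1/k^2 over odd k give the claim.

  The symmetry and the dilation property come from the energy identity: between two consecutive
  zeros |f n| is determined by the generalized arc sine.
\<close>

section \<open>Orthonormal sequences and L2\<close>

text \<open>The truncation at N survives the dilations: for each k >= 1 the map n -> k n is
  injective and sends indices above N to indices above N. So the sine coefficients of g that occur
  in the tail are those of g - P g, and Bessel applies for each k separately; summing over k costs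
  only the l1 norm of a. The choice of h lets a factor |R| cancel, because |h| is at most
  \<open>onorm (inv T)\<close> times |R|.

  The constant is the square root of (pi^2 / 8) / pi^2, that is 1 / (2 sqrt 2), times the bound for
  |f 1'|.

  The obstacle is that \<open>q_sine\<close> fixes each f n only on [0, 1], through its own boundary
  value problem, so f 1 (n x) has no meaning until f 1 is extended. The sine series of f 1 converges
  absolutely and supplies the odd 2-periodic extension; since it has only odd frequencies, it
  changes sign under a shift by 1, as the arcs of f n do.

  Completeness of the sines enters twice: to expand h, and to identify f 1 with its sine
  series.\<close>

lemma orthogonal_projection_residual:
  fixes e :: "'i \<Rightarrow> 'a::real_inner"
  assumes "finite A" "\<And>i j. i \<in> A \<Longrightarrow> j \<in> A \<Longrightarrow> inner (e i) (e j) = (if i = j then 1 else 0)"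
    and "y \<in> span (e ` A)"
  shows "inner (x - (\<Sum>i\<in>A. inner x (e i) *\<^sub>R e i)) y = 0"
  using assms(3)
proof (induction rule: span_induct_alt)
  case base
  show ?case by simp
next
  case (step c b y)
  then obtain j where j: "j \<in> A" "b = e j" by auto
  have "(\<Sum>i\<in>A. inner x (e i) * inner (e i) (e j)) = (\<Sum>i\<in>A. if i = j then inner x (e j) else 0)"
    using assms(2) j by (intro sum.cong) auto
  then have "inner (x - (\<Sum>i\<in>A. inner x (e i) *\<^sub>R e i)) b = 0"
    using j assms(1) by (simp add: inner_diff_left inner_sum_left)
  with step show ?case by (simp add: inner_add_right)
qed

text \<open>With p the projection, p - y lies in the span and x - p is orthogonal to it, so
  Pythagoras splits x - y.\<close>

lemma orthogonal_projection_best_approximation: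
  fixes e :: "'i \<Rightarrow> 'a::real_inner"
  assumes "finite A" "\<And>i j. i \<in> A \<Longrightarrow> j \<in> A \<Longrightarrow> inner (e i) (e j) = (if i = j then 1 else 0)"
    and "y \<in> span (e ` A)"
  shows "norm (x - (\<Sum>i\<in>A. inner x (e i) *\<^sub>R e i)) \<le> norm (x - y)"
proof -
  define p where "p = (\<Sum>i\<in>A. inner x (e i) *\<^sub>R e i)"
  have "p \<in> span (e ` A)"
    unfolding p_def by (intro span_sum span_scale span_base) auto
  then have "p - y \<in> span (e ` A)" using assms(3) by (rule span_diff)
  then have "inner (x - p) (p - y) = 0"
    unfolding p_def using assms(1,2) by (intro orthogonal_projection_residual) simp_all
  then have "(norm ((x - p) + (p - y)))\<^sup>2 = (norm (x - p))\<^sup>2 + (norm (p - y))\<^sup>2"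
    using norm_add_Pythagorean[of "x - p" "p - y"] by (simp only: orthogonal_def)
  then have "(norm (x - p))\<^sup>2 \<le> (norm (x - y))\<^sup>2" by simp
  then show ?thesis unfolding p_def by (simp add: power2_le_iff_abs_le)
qed

lemma Bessel_inequality:
  fixes e :: "'i \<Rightarrow> 'a::real_inner"
  assumes "finite A" "\<And>i j. i \<in> A \<Longrightarrow> j \<in> A \<Longrightarrow> inner (e i) (e j) = (if i = j then 1 else 0)"
  shows "(\<Sum>i\<in>A. (inner x (e i))\<^sup>2) \<le> (norm x)\<^sup>2"
proof -
  define p where "p = (\<Sum>i\<in>A. inner x (e i) *\<^sub>R e i)"
  have "p \<in> span (e ` A)"
    unfolding p_def by (intro span_sum span_scale span_base) auto
  then have "inner (x - p) p = 0"
    unfolding p_def using assms by (intro orthogonal_projection_residual) simp_all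
  moreover have "inner x p = (\<Sum>i\<in>A. (inner x (e i))\<^sup>2)"
    by (simp add: p_def inner_sum_right power2_eq_square)
  ultimately have *: "inner p p = (\<Sum>i\<in>A. (inner x (e i))\<^sup>2)" "inner x p = inner p p"
    by (simp_all add: inner_diff_left)
  have "0 \<le> inner (x - p) (x - p)" by simp
  then have "inner p p \<le> inner x x" using *(2)
    by (simp add: inner_diff_left inner_diff_right inner_commute)
  then show ?thesis using * by (simp add: power2_norm_eq_inner)
qed

text \<open>An approximant from the span uses finitely many \<open>e n\<close>, hence lies in the
  span of the first n of them for all large n, and the n-th partial sum is at least as close to
  x.\<close>

lemma orthonormal_expansion_tendsto:
  fixes e :: "nat \<Rightarrow> 'a::real_inner"
  assumes on: "\<And>i j. i \<ge> 1 \<Longrightarrow> j \<ge> 1 \<Longrightarrow> inner (e i) (e j) = (if i = j then 1 else 0)"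
    and "x \<in> closure (span (e ` {1..}))"
  shows "(\<lambda>M. \<Sum>n=1..M. inner x (e n) *\<^sub>R e n) \<longlonglongrightarrow> x"
proof (rule LIMSEQ_I)
  fix r :: real assume "r > 0"
  then obtain y where y: "y \<in> span (e ` {1..})" "dist y x < r"
    using assms(2) closure_approachable by blast
  obtain t c where t: "finite t" "t \<subseteq> e ` {1..}" "y = (\<Sum>a\<in>t. c a *\<^sub>R a)"
    using y(1) unfolding span_explicit by blast
  obtain B where B: "finite B" "B \<subseteq> {1..}" "t = e ` B"
    using finite_subset_image[OF t(1,2)] by blast
  show "\<exists>no. \<forall>n\<ge>no. norm ((\<Sum>n=1..n. inner x (e n) *\<^sub>R e n) - x) < r"
  \<comment> \<open>The inserted 0 keeps \<open>Max\<close> meaningful when B is empty.\<close>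
  proof (intro exI[of _ "Max (insert 0 B)"] allI impI)
    fix n assume n: "Max (insert 0 B) \<le> n"
    have "B \<subseteq> {1..n}" using B n by auto
    then have "t \<subseteq> e ` {1..n}" using B by auto
    then have "y \<in> span (e ` {1..n})"
      unfolding t(3) by (intro span_sum span_scale span_base) auto
    then have "norm (x - (\<Sum>n=1..n. inner x (e n) *\<^sub>R e n)) \<le> norm (x - y)"
      using on by (intro orthogonal_projection_best_approximation) simp_all
    also have "\<dots> < r" using y(2) by (simp add: dist_norm norm_minus_commute)
    finally show "norm ((\<Sum>n=1..n. inner x (e n) *\<^sub>R e n) - x) < r"
      by (simp add: norm_minus_commute)
  qed
qed

section \<open>Square-integrable functions and their classes in L2\<close>

lemma inner_to_L2:
  "square_integrable u \<Longrightarrow> square_integrable v \<Longrightarrow>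
    inner (to_L2 u) (to_L2 v) = (LINT x|unit_measure. u x * v x)"
  by transfer simp

lemma to_L2_add:
  "square_integrable u \<Longrightarrow> square_integrable v \<Longrightarrow> to_L2 u + to_L2 v = to_L2 (\<lambda>x. u x + v x)"
  by transfer (auto simp: ae_equal_def square_integrable_add)

lemma to_L2_scaleR:
  "square_integrable u \<Longrightarrow> c *\<^sub>R to_L2 u = to_L2 (\<lambda>x. c * u x)"
  by transfer (auto simp: ae_equal_def square_integrable_scale)

lemma to_L2_zero: "to_L2 (\<lambda>x. 0) = 0"
  by transfer (auto simp: ae_equal_def)

lemma square_integrable_diff:
  "square_integrable u \<Longrightarrow> square_integrable v \<Longrightarrow> square_integrable (\<lambda>x. u x - v x)"
  using square_integrable_add[of u "\<lambda>x. (-1) * v x"] square_integrable_scale[of v "-1"] by simp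

lemma to_L2_diff:
  assumes "square_integrable u" "square_integrable v"
  shows "to_L2 u - to_L2 v = to_L2 (\<lambda>x. u x - v x)"
proof -
  have "to_L2 u - to_L2 v = to_L2 u + (-1) *\<^sub>R to_L2 v" by simp
  also have "\<dots> = to_L2 (\<lambda>x. u x + (-1) * v x)"
    using assms by (simp only: to_L2_scaleR to_L2_add square_integrable_scale)
  finally show ?thesis by simp
qed

lemma square_integrable_sum:
  "(\<And>i. i \<in> A \<Longrightarrow> square_integrable (u i)) \<Longrightarrow> square_integrable (\<lambda>x. \<Sum>i\<in>A. u i x)"
  by (induction A rule: infinite_finite_induct) (auto intro: square_integrable_add)

lemma to_L2_sum:
  "finite A \<Longrightarrow> (\<And>i. i \<in> A \<Longrightarrow> square_integrable (u i)) \<Longrightarrow>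
    to_L2 (\<lambda>x. \<Sum>i\<in>A. u i x) = (\<Sum>i\<in>A. to_L2 (u i))"
  by (induction A rule: finite_induct)
     (auto simp: to_L2_zero to_L2_add[symmetric] square_integrable_sum)

lemma to_L2_cong:
  assumes "\<And>x. 0 < x \<Longrightarrow> x < 1 \<Longrightarrow> u x = v x" "square_integrable u" "square_integrable v"
  shows "to_L2 u = to_L2 v"
proof -
  have "AE x in unit_measure. u x = v x"
    by (intro AE_I2) (use assms(1) in \<open>auto simp: space_restrict_space\<close>)
  then show ?thesis using assms(2,3)
    by transfer (auto simp: ae_equal_def)
qed

lemma to_L2_surjective:
  obtains u where "square_integrable u" "x = to_L2 u"
proof -
  have "\<exists>u. square_integrable u \<and> x = to_L2 u"
  proof (transfer)
    fix x assume "ae_equal x x"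
    then show "\<exists>u. square_integrable u \<and> ae_equal x (if square_integrable u then u else (\<lambda>x. 0))"
      by (auto simp: ae_equal_def)
  qed
  then show ?thesis using that by blast
qed

lemma norm_to_L2:
  "square_integrable u \<Longrightarrow> (norm (to_L2 u))\<^sup>2 = (LINT x|unit_measure. (u x)\<^sup>2)"
  unfolding power2_norm_eq_inner by (simp add: inner_to_L2 power2_eq_square)

lemma finite_measure_unit: "finite_measure unit_measure"
  by (rule finite_measureI) (simp add: space_restrict_space emeasure_restrict_space)

lemma measure_unit: "measure unit_measure (space unit_measure) = 1"
  by (simp add: space_restrict_space measure_restrict_space)

lemma square_integrable_bounded:
  assumes "u \<in> borel_measurable unit_measure" "AE x in unit_measure. \<bar>u x\<bar> \<le> w x"
    "square_integrable w"
  shows "square_integrable u"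
  unfolding square_integrable_def
proof
  show "u \<in> borel_measurable unit_measure" by fact
  show "integrable unit_measure (\<lambda>x. (u x)\<^sup>2)"
  proof (rule Bochner_Integration.integrable_bound)
    show "integrable unit_measure (\<lambda>x. (w x)\<^sup>2)" using assms by (simp add: square_integrable_def)
    show "AE x in unit_measure. norm ((u x)\<^sup>2) \<le> norm ((w x)\<^sup>2)"
      using assms(2)
    proof eventually_elim
      case (elim x)
      then have "\<bar>u x\<bar> \<le> \<bar>w x\<bar>" by linarith
      then show ?case by (simp add: abs_le_square_iff)
    qed
  qed (use assms(1) in measurable)
qed

lemma square_integrable_const: "square_integrable (\<lambda>x. c)"
  unfolding square_integrable_def
  using finite_measure.integrable_const[OF finite_measure_unit] by auto

lemma borel_measurable_unit_continuous:
  "continuous_on {0..1} u \<Longrightarrow> u \<in> borel_measurable unit_measure"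
  by (rule continuous_imp_measurable_on_sets_lebesgue[OF continuous_on_subset]) auto

lemma square_integrable_continuous:
  assumes "continuous_on {0..1} u"
  shows "square_integrable u"
proof -
  have "bounded (u ` {0..1})"
    using assms compact_continuous_image compact_imp_bounded by blast
  then obtain B where B: "\<And>x. x \<in> {0..1} \<Longrightarrow> \<bar>u x\<bar> \<le> B"
    unfolding bounded_iff by fastforce
  show ?thesis
    by (rule square_integrable_bounded[OF borel_measurable_unit_continuous[OF assms] _
          square_integrable_const[of B]])
       (auto intro!: AE_I2 B simp: space_restrict_space)
qed

text \<open>Dominated convergence for the squared differences, which are at most
  \<open>(2 * w x)^2\<close> almost everywhere. Every approximation in the density argument, and the
  dilated sine series later, goes through this rule.\<close>

lemma to_L2_dominated_tendsto:
  assumes "\<And>i. u i \<in> borel_measurable unit_measure" "v \<in> borel_measurable unit_measure"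
    and "square_integrable w" "\<And>i. AE x in unit_measure. \<bar>u i x\<bar> \<le> w x"
    and lim: "AE x in unit_measure. (\<lambda>i. u i x) \<longlonglongrightarrow> v x"
  shows "square_integrable v" "(\<lambda>i. to_L2 (u i)) \<longlonglongrightarrow> to_L2 v"
proof -
  have su: "square_integrable (u i)" for i
    by (rule square_integrable_bounded[OF assms(1,4,3)])
  have all: "AE x in unit_measure. \<forall>i. \<bar>u i x\<bar> \<le> w x" using assms(4) by (simp add: AE_all_countable)
  have vw: "AE x in unit_measure. \<bar>v x\<bar> \<le> w x"
    using all lim
  proof eventually_elim
    case (elim x)
    then show ?case by (intro LIMSEQ_le_const2[OF tendsto_rabs]) auto
  qed
  then show sv: "square_integrable v"
    by (rule square_integrable_bounded[OF assms(2) _ assms(3)])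
  have "(\<lambda>i. LINT x|unit_measure. (u i x - v x)\<^sup>2) \<longlonglongrightarrow> (LINT x|unit_measure. 0)"
  proof (rule integral_dominated_convergence)
    show "integrable unit_measure (\<lambda>x. (2 * w x)\<^sup>2)"
      using square_integrable_scale[OF assms(3), of 2] by (simp only: square_integrable_def)
    show "AE x in unit_measure. (\<lambda>i. (u i x - v x)\<^sup>2) \<longlonglongrightarrow> 0"
      using lim by eventually_elim (auto intro!: tendsto_eq_intros)
    fix i
    show "AE x in unit_measure. norm ((u i x - v x)\<^sup>2) \<le> (2 * w x)\<^sup>2"
      using all vw
    proof eventually_elim
      case (elim x)
      then have "\<bar>u i x\<bar> \<le> w x" by blast
      then have "\<bar>u i x - v x\<bar> \<le> 2 * w x" using elim by linarith
      then have "\<bar>u i x - v x\<bar> \<le> \<bar>2 * w x\<bar>" by linarith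
      then show ?case by (simp only: abs_le_square_iff) simp
    qed
  qed (use assms in auto)
  then have "(\<lambda>i. (norm (to_L2 (u i) - to_L2 v))\<^sup>2) \<longlonglongrightarrow> 0"
    by (simp add: to_L2_diff su sv norm_to_L2 square_integrable_diff)
  then have "(\<lambda>i. sqrt ((norm (to_L2 (u i) - to_L2 v))\<^sup>2)) \<longlonglongrightarrow> sqrt 0"
    by (rule tendsto_real_sqrt)
  then show "(\<lambda>i. to_L2 (u i)) \<longlonglongrightarrow> to_L2 v"
    by (simp add: LIM_zero_cancel tendsto_norm_zero_iff)
qed

lemma closure_sequentially:
  fixes a :: "nat \<Rightarrow> 'a::metric_space"
  assumes "a \<longlonglongrightarrow> x" "\<And>i. a i \<in> closure S"
  shows "x \<in> closure S"
  using closed_sequentially[OF closed_closure assms(2,1)] .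

section \<open>Completeness of the sine basis\<close>

text \<open>The bridge from the Lebesgue integral on the open interval to the gauge integral on the
  closed one, where the fundamental theorem of calculus is available.\<close>

lemma LINT_unit_continuous:
  fixes u :: "real \<Rightarrow> real"
  assumes "continuous_on {0..1} u"
  shows "(LINT x|unit_measure. u x) = integral {0..1} u"
proof -
  have "square_integrable u" "square_integrable (\<lambda>x. 1)"
    using assms by (auto intro: square_integrable_continuous square_integrable_const)
  from square_integrable_mult[OF this] have "integrable unit_measure u" by simp
  then have "(LINT x|unit_measure. u x) = integral {0<..<1} u"
    by (intro lebesgue_integral_eq_integral) auto
  also have "\<dots> = integral {0..1} u"
    using integral_open_interval[of 0 1 u] by simp
  finally show ?thesis .
qed

lemma LINT_unit_FTC:
  assumes "continuous_on {0..1} u"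
    and "\<And>x. 0 \<le> x \<Longrightarrow> x \<le> 1 \<Longrightarrow> (F has_real_derivative u x) (at x within {0..1})"
  shows "(LINT x|unit_measure. u x) = F 1 - F 0"
proof -
  have "(u has_integral F 1 - F 0) {0..1}"
    using assms(2)
    by (intro fundamental_theorem_of_calculus)
       (auto simp: has_real_derivative_iff_has_vector_derivative[symmetric])
  then show ?thesis by (simp add: LINT_unit_continuous[OF assms(1)] integral_unique)
qed

text \<open>If F is a primitive of u, then \<open>- F (1 - x)\<close> is a primitive of
  \<open>u (1 - x)\<close> with the same increment over [0, 1].\<close>

lemma LINT_unit_reflect:
  fixes u :: "real \<Rightarrow> real"
  assumes "continuous_on {0..1} u"
  shows "(LINT x|unit_measure. u (1 - x)) = (LINT x|unit_measure. u x)"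
proof -
  define F where "F x = integral {0..x} u" for x
  have F: "(F has_real_derivative u x) (at x within {0..1})" if "0 \<le> x" "x \<le> 1" for x
    unfolding F_def using integral_has_real_derivative[OF assms] that by auto
  have "(LINT x|unit_measure. u (1 - x)) = (- F (1 - 1)) - (- F (1 - 0))"
  proof (rule LINT_unit_FTC)
    show "continuous_on {0..1} (\<lambda>x. u (1 - x))"
      by (rule continuous_on_compose2[OF assms]) (auto intro!: continuous_intros)
    fix x :: real assume x: "0 \<le> x" "x \<le> 1"
    have "((\<lambda>x. F (1 - x)) has_real_derivative u (1 - x) * (0 - 1)) (at x within {0..1})"
    proof (rule DERIV_image_chain[where f = F and g = "\<lambda>x. 1 - x", unfolded o_def])
      show "(F has_real_derivative u (1 - x)) (at (1 - x) within (\<lambda>x. 1 - x) ` {0..1})"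
        by (rule DERIV_subset[OF F]) (use x in auto)
      show "((\<lambda>x. 1 - x) has_real_derivative 0 - 1) (at x within {0..1})"
        by (auto intro!: derivative_eq_intros)
    qed
    then have "((\<lambda>x. - F (1 - x)) has_real_derivative - (u (1 - x) * (0 - 1))) (at x within {0..1})"
      by (rule DERIV_minus)
    then show "((\<lambda>x. - F (1 - x)) has_real_derivative u (1 - x)) (at x within {0..1})"
      by simp
  qed
  also have "\<dots> = F 1 - F 0" by simp
  also have "\<dots> = (LINT x|unit_measure. u x)"
    using LINT_unit_FTC[OF assms F] by simp
  finally show ?thesis .
qed

text \<open>The frequency is an integer because the product-to-sum formulas produce
  \<open>int m - int n\<close>, which may be negative.\<close>

lemma LINT_unit_cos:
  fixes k :: int
  shows "(LINT x|unit_measure. cos (of_int k * pi * x)) = (if k = 0 then 1 else 0)"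
proof (cases "k = 0")
  case True
  then show ?thesis using measure_unit by simp
next
  case False
  have "(LINT x|unit_measure. cos (of_int k * pi * x)) =
      sin (of_int k * pi * 1) / (of_int k * pi) - sin (of_int k * pi * 0) / (of_int k * pi)"
    using False by (intro LINT_unit_FTC) (auto intro!: continuous_intros derivative_eq_intros)
  also have "\<dots> = 0" by (simp add: sin_times_pi_eq_0)
  finally show ?thesis using False by simp
qed

lemma square_integrable_sine: "square_integrable (\<lambda>x. c * sin (a * x))"
  and square_integrable_cosine: "square_integrable (\<lambda>x. c * cos (a * x))"
  by (auto intro!: square_integrable_continuous continuous_intros)

lemma integrable_unit_cos: "integrable unit_measure (\<lambda>x. cos (a * x))"
  using square_integrable_mult[OF square_integrable_cosine[of 1 a] square_integrable_const[of 1]] by simp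

lemma inner_sine_basis:
  assumes "m \<ge> 1" "n \<ge> 1"
  shows "inner (sine_basis m) (sine_basis n) = (if m = n then 1 else 0)"
proof -
  have *: "(sqrt 2 * sin (real m * pi * x)) * (sqrt 2 * sin (real n * pi * x)) =
      cos (of_int (int m - int n) * pi * x) - cos (of_int (int m + int n) * pi * x)" for x
  proof -
    have "(sqrt 2 * sin (real m * pi * x)) * (sqrt 2 * sin (real n * pi * x)) =
        2 * (sin (real m * pi * x) * sin (real n * pi * x))"
      by (simp add: mult_ac)
    also have "\<dots> = cos (real m * pi * x - real n * pi * x) - cos (real m * pi * x + real n * pi * x)"
      by (simp add: cos_add cos_diff)
    finally show ?thesis by (simp add: algebra_simps)
  qed
  have "inner (sine_basis m) (sine_basis n) =
    (LINT x|unit_measure. cos (of_int (int m - int n) * pi * x) - cos (of_int (int m + int n) * pi * x))"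
    unfolding sine_basis_def by (simp only: inner_to_L2 square_integrable_sine *)
  also have "\<dots> = (LINT x|unit_measure. cos (of_int (int m - int n) * pi * x)) -
      (LINT x|unit_measure. cos (of_int (int m + int n) * pi * x))"
    by (intro Bochner_Integration.integral_diff integrable_unit_cos)
  also have "\<dots> = (if m = n then 1 else 0)"
    using assms by (simp only: LINT_unit_cos) auto
  finally show ?thesis .
qed

text \<open>Serves to measure the derivative of a q-sine. At index 0 it is the constant sqrt 2, not
  a unit vector, so orthonormality starts at index 1.\<close>

definition cosine_basis :: "nat \<Rightarrow> L2"
  where "cosine_basis n = to_L2 (\<lambda>x. sqrt 2 * cos (real n * pi * x))"

lemma inner_cosine_basis:
  assumes "m \<ge> 1" "n \<ge> 1"
  shows "inner (cosine_basis m) (cosine_basis n) = (if m = n then 1 else 0)"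
proof -
  have *: "(sqrt 2 * cos (real m * pi * x)) * (sqrt 2 * cos (real n * pi * x)) =
      cos (of_int (int m - int n) * pi * x) + cos (of_int (int m + int n) * pi * x)" for x
  proof -
    have "(sqrt 2 * cos (real m * pi * x)) * (sqrt 2 * cos (real n * pi * x)) =
        2 * (cos (real m * pi * x) * cos (real n * pi * x))"
      by (simp add: mult_ac)
    also have "\<dots> = cos (real m * pi * x - real n * pi * x) + cos (real m * pi * x + real n * pi * x)"
      by (simp add: cos_add cos_diff)
    finally show ?thesis by (simp add: algebra_simps)
  qed
  have "inner (cosine_basis m) (cosine_basis n) =
    (LINT x|unit_measure. cos (of_int (int m - int n) * pi * x) + cos (of_int (int m + int n) * pi * x))"
    unfolding cosine_basis_def by (simp only: inner_to_L2 square_integrable_cosine *)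
  also have "\<dots> = (LINT x|unit_measure. cos (of_int (int m - int n) * pi * x)) +
      (LINT x|unit_measure. cos (of_int (int m + int n) * pi * x))"
    by (intro Bochner_Integration.integral_add integrable_unit_cos)
  also have "\<dots> = (if m = n then 1 else 0)"
    using assms by (simp only: LINT_unit_cos) auto
  finally show ?thesis .
qed

text \<open>Multiplication by cos (pi x) preserves the span, since sin (n s) cos s is the mean of
  sin ((n + 1) s) and sin ((n - 1) s). The frequency is generalized in the induction because it
  moves both ways; frequency 0 contributes the zero function.\<close>

lemma sine_cosine_power_in_span:
  "to_L2 (\<lambda>x. sin (real n * pi * x) * cos (pi * x) ^ m) \<in> span (sine_basis ` {1..})"
proof (induction m arbitrary: n)
  case 0
  show ?case
  proof (cases "n = 0")
    case True
    then show ?thesis by (simp add: to_L2_zero span_zero)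
  next
    case False
    have "(1 / sqrt 2) *\<^sub>R sine_basis n = to_L2 (\<lambda>x. sin (real n * pi * x))"
      unfolding sine_basis_def by (simp add: to_L2_scaleR square_integrable_sine)
    moreover have "(1 / sqrt 2) *\<^sub>R sine_basis n \<in> span (sine_basis ` {1..})"
      using False by (intro span_scale span_base) auto
    ultimately show ?thesis by simp
  qed
next
  case (Suc m)
  let ?S = "\<lambda>n x. sin (real n * pi * x) * cos (pi * x) ^ m"
  have si: "square_integrable (?S n)" for n
    by (auto intro!: square_integrable_continuous continuous_intros)
  show ?case
  proof (cases n)
    case 0
    then show ?thesis by (simp add: to_L2_zero span_zero)
  next
    case (Suc j)
    have "sin (real n * pi * x) * cos (pi * x) ^ Suc m = (1/2) * (?S (Suc n) x + ?S j x)" for x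
    proof -
      have "sin (real (Suc n) * pi * x) + sin (real j * pi * x) =
          sin (real n * pi * x + pi * x) + sin (real n * pi * x - pi * x)"
        unfolding Suc by (simp add: algebra_simps)
      also have "\<dots> = 2 * (sin (real n * pi * x) * cos (pi * x))"
        by (simp add: sin_add sin_diff)
      finally show ?thesis by (simp add: distrib_right[symmetric])
    qed
    then have "to_L2 (\<lambda>x. sin (real n * pi * x) * cos (pi * x) ^ Suc m) =
        (1/2) *\<^sub>R (to_L2 (?S (Suc n)) + to_L2 (?S j))"
      by (simp only: to_L2_add to_L2_scaleR si square_integrable_add)
    also have "\<dots> \<in> span (sine_basis ` {1..})"
      by (intro span_scale span_add Suc.IH)
    finally show ?thesis .
  qed
qed

text \<open>On [0, 1] the map x -> cos (pi x) is a homeomorphism onto [-1, 1], so u is a continuous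
  function c of cos (pi x). Weierstrass replaces c by polynomials, and a sine times a polynomial in
  the cosine lies in the span.\<close>

lemma sine_times_continuous_in_closure:
  assumes "continuous_on {0..1} u"
  shows "to_L2 (\<lambda>x. sin (pi * x) * u x) \<in> closure (span (sine_basis ` {1..}))"
proof -
  define c where "c t = u (arccos t / pi)" for t
  have c: "continuous_on {-1..1} c"
    unfolding c_def
    by (intro continuous_on_compose2[OF assms] continuous_intros continuous_on_arccos')
       (auto simp: arccos_lbound arccos_ubound)
  have uc: "u x = c (cos (pi * x))" if "0 \<le> x" "x \<le> 1" for x
    using that by (simp add: c_def arccos_cos)
  have "\<exists>p. \<forall>t\<in>{-1..1}. real_polynomial_function p \<and> \<bar>c t - p t\<bar> < inverse (real (Suc i))" for i
    using Stone_Weierstrass_real_polynomial_function[OF compact_Icc c, of "inverse (real (Suc i))"]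
    by (metis inverse_positive_iff_positive of_nat_0_less_iff zero_less_Suc)
  then obtain p where p': "\<And>i. \<forall>t\<in>{-1..1}.
      real_polynomial_function (p i) \<and> \<bar>c t - p i t\<bar> < inverse (real (Suc i))"
    by metis
  then have p: "\<And>i t. t \<in> {-1..1} \<Longrightarrow> \<bar>c t - p i t\<bar> < inverse (real (Suc i))" by blast
  have pp: "real_polynomial_function (p i)" for i using p'[of i] by (auto dest: bspec[of _ _ 0])
  have pc: "continuous_on S (p i)" for i S
    using pp[of i] by (simp add: continuous_on_polymonial_function real_polynomial_function_eq)
  have in_span: "to_L2 (\<lambda>x. sin (pi * x) * p i (cos (pi * x))) \<in> span (sine_basis ` {1..})" for i
  proof -
    obtain a n where a: "p i = (\<lambda>x. \<Sum>k\<le>n. a k * x ^ k)"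
      using pp[of i] unfolding real_polynomial_function_iff_sum by blast
    let ?t = "\<lambda>k x. sin (real 1 * pi * x) * cos (pi * x) ^ k"
    have si: "square_integrable (?t k)" for k
      by (auto intro!: square_integrable_continuous continuous_intros)
    have "to_L2 (\<lambda>x. sin (pi * x) * p i (cos (pi * x))) = to_L2 (\<lambda>x. \<Sum>k\<le>n. a k * ?t k x)"
      unfolding a by (simp add: sum_distrib_left mult_ac)
    also have "\<dots> = (\<Sum>k\<le>n. a k *\<^sub>R to_L2 (?t k))"
      by (simp only: to_L2_sum[OF finite_atMost] square_integrable_scale si to_L2_scaleR)
    also have "\<dots> \<in> span (sine_basis ` {1..})"
      by (intro span_sum span_scale sine_cosine_power_in_span)
    finally show ?thesis .
  qed
  have "bounded (c ` {-1..1})"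
    using c compact_continuous_image compact_imp_bounded by blast
  then obtain B where B: "\<And>t. t \<in> {-1..1} \<Longrightarrow> \<bar>c t\<bar> \<le> B" unfolding bounded_iff by fastforce
  have "(\<lambda>i. to_L2 (\<lambda>x. sin (pi * x) * p i (cos (pi * x)))) \<longlonglongrightarrow> to_L2 (\<lambda>x. sin (pi * x) * u x)"
  \<comment> \<open>B bounds c, and the polynomials differ from c by less than
    \<open>inverse (real (Suc i))\<close>, which is at most 1.\<close>
  proof (rule to_L2_dominated_tendsto(2)[where w = "\<lambda>x. B + 1"])
    fix i
    show "(\<lambda>x. sin (pi * x) * p i (cos (pi * x))) \<in> borel_measurable unit_measure"
      by (auto intro!: borel_measurable_unit_continuous continuous_intros continuous_on_compose2[OF pc])
    have "\<bar>sin (pi * x) * p i (cos (pi * x))\<bar> \<le> B + 1" for x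
    proof -
      have "\<bar>p i (cos (pi * x))\<bar> \<le> B + 1"
        using B[of "cos (pi * x)"] p[of "cos (pi * x)" i] inverse_le_1_iff[of "real (Suc i)"] by auto
      moreover have "\<bar>sin (pi * x)\<bar> * \<bar>p i (cos (pi * x))\<bar> \<le> 1 * \<bar>p i (cos (pi * x))\<bar>"
        by (intro mult_right_mono) auto
      ultimately show ?thesis by (simp add: abs_mult)
    qed
    then show "AE x in unit_measure. \<bar>sin (pi * x) * p i (cos (pi * x))\<bar> \<le> B + 1" by simp
  next
    show "AE x in unit_measure. (\<lambda>i. sin (pi * x) * p i (cos (pi * x))) \<longlonglongrightarrow> sin (pi * x) * u x"
    proof (intro AE_I2 tendsto_mult tendsto_const)
      fix x assume "x \<in> space unit_measure"
      then have x: "0 \<le> x" "x \<le> 1" by (auto simp: space_restrict_space)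
      have "(\<lambda>i. p i (cos (pi * x)) - c (cos (pi * x))) \<longlonglongrightarrow> 0"
      proof (rule Lim_null_comparison[OF _ LIMSEQ_inverse_real_of_nat])
        show "\<forall>\<^sub>F i in sequentially. norm (p i (cos (pi * x)) - c (cos (pi * x))) \<le> inverse (real (Suc i))"
          using p[of "cos (pi * x)"] by (intro always_eventually) (auto simp: abs_minus_commute less_imp_le)
      qed
      then show "(\<lambda>i. p i (cos (pi * x))) \<longlonglongrightarrow> u x"
        using uc[OF x] by (simp add: LIM_zero_cancel)
    qed
  qed (auto intro!: borel_measurable_unit_continuous continuous_intros assms square_integrable_const)
  then show ?thesis
    by (rule closure_sequentially) (rule closure_subset[THEN subsetD, OF in_span])
qed

lemma continuous_in_closure_sine_span:
  assumes "continuous_on {0..1} u"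
  shows "to_L2 u \<in> closure (span (sine_basis ` {1..}))"
proof -
  \<comment> \<open>u is the limit of sin * (u / max sin (1/i)), whose second factor is continuous even where
    sin vanishes.\<close>
  let ?m = "\<lambda>i x. max (sin (pi * x)) (inverse (real (Suc i)))"
  have m0: "?m i x > 0" for i x by (simp add: less_max_iff_disj)
  have cont: "continuous_on {0..1} (\<lambda>x. u x / ?m i x)" for i
    using m0 by (intro continuous_intros assms) (metis less_irrefl)
  have "(\<lambda>i. to_L2 (\<lambda>x. sin (pi * x) * (u x / ?m i x))) \<longlonglongrightarrow> to_L2 u"
  proof (rule to_L2_dominated_tendsto(2)[where w = "\<lambda>x. \<bar>u x\<bar>"])
    fix i
    show "(\<lambda>x. sin (pi * x) * (u x / ?m i x)) \<in> borel_measurable unit_measure"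
      by (intro borel_measurable_unit_continuous continuous_on_mult cont continuous_intros)
    show "AE x in unit_measure. \<bar>sin (pi * x) * (u x / ?m i x)\<bar> \<le> \<bar>u x\<bar>"
    proof (intro AE_I2)
      fix x assume "x \<in> space unit_measure"
      then have "0 \<le> x" "x \<le> 1" by (auto simp: space_restrict_space)
      then have "sin (pi * x) \<ge> 0" by (intro sin_ge_zero) (auto simp: mult_left_le)
      then have "\<bar>u x\<bar> * \<bar>sin (pi * x)\<bar> \<le> \<bar>u x\<bar> * ?m i x" by (intro mult_left_mono) auto
      then show "\<bar>sin (pi * x) * (u x / ?m i x)\<bar> \<le> \<bar>u x\<bar>"
        using m0[of x i] by (simp add: abs_mult abs_div_pos[symmetric] pos_divide_le_eq mult_ac)
    qed
  next
    show "AE x in unit_measure. (\<lambda>i. sin (pi * x) * (u x / ?m i x)) \<longlonglongrightarrow> u x"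
    proof (intro AE_I2)
      fix x assume "x \<in> space unit_measure"
      then have "0 < x" "x < 1" by (auto simp: space_restrict_space)
      then have s: "sin (pi * x) > 0" by (intro sin_gt_zero) auto
      have "\<forall>\<^sub>F i in sequentially. inverse (real (Suc i)) < sin (pi * x)"
        using s LIMSEQ_inverse_real_of_nat order_tendstoD(2) by blast
      then have "\<forall>\<^sub>F i in sequentially. sin (pi * x) * (u x / ?m i x) = u x"
        by eventually_elim (use s in \<open>simp add: max_absorb1\<close>)
      then show "(\<lambda>i. sin (pi * x) * (u x / ?m i x)) \<longlonglongrightarrow> u x" by (rule tendsto_eventually)
    qed
  qed (auto intro!: borel_measurable_unit_continuous square_integrable_continuous continuous_intros assms)
  moreover have "to_L2 (\<lambda>x. sin (pi * x) * (u x / ?m i x)) \<in> closure (span (sine_basis ` {1..}))" for i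
    by (rule sine_times_continuous_in_closure[OF cont])
  ultimately show ?thesis
    by (rule closure_sequentially)
qed

text \<open>A measurable function is an almost everywhere limit of continuous ones. Clipping these
  to [-B, B] supplies a dominating constant and leaves the limit alone, since u itself takes values
  there.\<close>

lemma bounded_in_closure_sine_span:
  assumes u: "u \<in> borel_measurable unit_measure" and B: "\<And>x. \<bar>u x\<bar> \<le> B"
  shows "to_L2 u \<in> closure (span (sine_basis ` {1..}))"
proof -
  have "(\<lambda>x. if x \<in> {0<..<1} then u x else 0) \<in> borel_measurable lebesgue"
    by (rule borel_measurable_if_I[OF u]) auto
  then have "(\<lambda>x. if x \<in> {0<..<1} then u x else 0) measurable_on {0<..<1}"
    by (rule lebesgue_measurable_imp_measurable_on) auto
  then obtain Z w where Z: "negligible Z" and w: "\<And>i. continuous_on UNIV (w i)"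
    and lim: "\<And>x. x \<notin> Z \<Longrightarrow>
      (\<lambda>i. w i x) \<longlonglongrightarrow> (if x \<in> {0<..<1} then if x \<in> {0<..<1} then u x else 0 else 0)"
    unfolding measurable_on_def by blast
  have B0: "0 \<le> B" using B[of 0] by linarith
  let ?c = "\<lambda>i x. max (- B) (min B (w i x))"
  have cont: "continuous_on {0..1} (?c i)" for i
    by (intro continuous_intros continuous_on_subset[OF w]) auto
  have "(\<lambda>i. to_L2 (?c i)) \<longlonglongrightarrow> to_L2 u"
  proof (rule to_L2_dominated_tendsto(2)[where w = "\<lambda>x. B"])
    have "AE x in lebesgue. x \<notin> Z"
      using Z by (simp add: AE_not_in negligible_iff_null_sets)
    then have "AE x in lebesgue. x \<in> {0<..<1} \<longrightarrow> (\<lambda>i. ?c i x) \<longlonglongrightarrow> u x"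
    proof eventually_elim
      case (elim x)
      show ?case
      proof
        assume "x \<in> {0<..<1}"
        then have "(\<lambda>i. w i x) \<longlonglongrightarrow> u x" using lim[OF elim] by simp
        then have "(\<lambda>i. ?c i x) \<longlonglongrightarrow> max (- B) (min B (u x))" by (intro tendsto_intros)
        also have "max (- B) (min B (u x)) = u x" using B[of x] by linarith
        finally show "(\<lambda>i. ?c i x) \<longlonglongrightarrow> u x" .
      qed
    qed
    then show "AE x in unit_measure. (\<lambda>i. ?c i x) \<longlonglongrightarrow> u x"
      by (simp add: AE_restrict_space_iff)
  qed (use B0 u cont in \<open>auto intro!: borel_measurable_unit_continuous square_integrable_const\<close>)
  moreover have "to_L2 (?c i) \<in> closure (span (sine_basis ` {1..}))" for i
    by (rule continuous_in_closure_sine_span[OF cont])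
  ultimately show ?thesis
    by (rule closure_sequentially)
qed

text \<open>A representative u is truncated at height i: the truncations are bounded, dominated by
  |u|, and at each point eventually equal to u.\<close>

lemma closure_sine_span: "x \<in> closure (span (sine_basis ` {1..}))"
proof -
  obtain u where u: "square_integrable u" "x = to_L2 u" by (rule to_L2_surjective)
  let ?c = "\<lambda>i x. max (- real i) (min (real i) (u x))"
  have meas: "u \<in> borel_measurable unit_measure" using u by (simp add: square_integrable_def)
  have cm: "?c i \<in> borel_measurable unit_measure" for i
    by (intro borel_measurable_max borel_measurable_min meas borel_measurable_const)
  have "(\<lambda>i. to_L2 (?c i)) \<longlonglongrightarrow> to_L2 u"
  proof (rule to_L2_dominated_tendsto(2)[where w = "\<lambda>x. \<bar>u x\<bar>"])
    show "square_integrable (\<lambda>x. \<bar>u x\<bar>)" using u(1) by (auto simp: square_integrable_def)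
    show "AE x in unit_measure. (\<lambda>i. ?c i x) \<longlonglongrightarrow> u x"
    proof (intro AE_I2 tendsto_eventually)
      fix x
      obtain k where k: "\<bar>u x\<bar> \<le> real k" using real_arch_simple by blast
      show "\<forall>\<^sub>F i in sequentially. ?c i x = u x"
        using eventually_ge_at_top[of k]
      proof eventually_elim
        case (elim i)
        then have "real k \<le> real i" by simp
        with k show ?case by linarith
      qed
    qed
  qed (use meas cm in auto)
  moreover have "to_L2 (?c i) \<in> closure (span (sine_basis ` {1..}))" for i
    by (rule bounded_in_closure_sine_span[OF cm, of _ "real i"]) linarith
  ultimately show ?thesis
    unfolding u(2) by (rule closure_sequentially)
qed

section \<open>The generalized arc sine\<close>

lemma signed_powr_sgn: "signed_powr z a = sgn z * \<bar>z\<bar> powr a"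
proof (cases "z = 0")
  case False
  then have "\<bar>z\<bar> * \<bar>z\<bar> powr (a - 1) = \<bar>z\<bar> powr a" by (simp add: powr_diff)
  moreover have "signed_powr z a = sgn z * (\<bar>z\<bar> * \<bar>z\<bar> powr (a - 1))"
    unfolding signed_powr_def by (simp add: mult.assoc[symmetric] sgn_mult_abs)
  ultimately show ?thesis by simp
qed (simp add: signed_powr_def)

lemma signed_powr_0 [simp]: "signed_powr 0 a = 0"
  by (simp add: signed_powr_def)

lemma signed_powr_minus: "signed_powr (- z) a = - signed_powr z a"
  by (simp add: signed_powr_def)

lemma signed_powr_pos: "z > 0 \<Longrightarrow> signed_powr z a = z powr a"
  by (simp add: signed_powr_sgn)

lemma signed_powr_less_iff:
  assumes "a > 0"
  shows "signed_powr y a < signed_powr z a \<longleftrightarrow> y < z"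
proof -
  have 1: "signed_powr y a < signed_powr z a" if "y < z" for y z
  proof -
    consider "0 \<le> y" | "y < 0" "0 \<le> z" | "z < 0" by linarith
    then show ?thesis
    proof cases
      case 1
      with that assms show ?thesis
        by (cases "y = 0") (auto simp: signed_powr_pos powr_less_mono2)
    next
      case 2
      then show ?thesis by (cases "z = 0") (auto simp: signed_powr_sgn intro: less_trans[of _ 0])
    next
      case 3
      with that assms have "(- z) powr a < (- y) powr a" by (intro powr_less_mono2) auto
      with 3 that show ?thesis by (simp add: signed_powr_sgn)
    qed
  qed
  show ?thesis using 1[of y z] 1[of z y] by (cases y z rule: linorder_cases) auto
qed

text \<open>The differential equation controls \<open>signed_powr v' (q - 1)\<close>; this recovers
  v' from it.\<close>

lemma signed_powr_inverse:
  assumes "a > 0"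
  shows "signed_powr (signed_powr z a) (1 / a) = z"
  using assms by (simp add: signed_powr_sgn abs_mult powr_powr sgn_mult sgn_mult_abs abs_sgn_eq)

lemma continuous_on_signed_powr:
  assumes "a > 0"
  shows "continuous_on S (\<lambda>z. signed_powr z a)"
proof -
  \<comment> \<open>Splitting into positive and negative part keeps both bases of
    \<open>powr\<close> nonnegative.\<close>
  have "signed_powr z a = max z 0 powr a - max (- z) 0 powr a" for z
    by (auto simp: signed_powr_sgn sgn_if max_def)
  moreover have "continuous_on S (\<lambda>z::real. max z 0 powr a - max (- z) 0 powr a)"
    using assms by (intro continuous_intros continuous_on_powr') auto
  ultimately show ?thesis by simp
qed

text \<open>At 0 the difference quotient is bounded by \<open>|h| powr (p - 1)\<close>, which tends
  to 0 because p > 1. The energy identity applies this both to q and to its conjugate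
  exponent.\<close>

lemma DERIV_abs_powr:
  fixes p :: real
  assumes "p > 1"
  shows "((\<lambda>z. \<bar>z\<bar> powr p) has_real_derivative p * signed_powr z (p - 1)) (at z)"
proof -
  have pos: "((\<lambda>z. \<bar>z\<bar> powr p) has_real_derivative p * signed_powr z (p - 1)) (at z)" if "z > 0" for z
  proof (rule DERIV_cong_ev[THEN iffD1, OF refl _ refl])
    show "((\<lambda>z. z powr p) has_real_derivative p * signed_powr z (p - 1)) (at z)"
      using that by (auto intro!: derivative_eq_intros simp: signed_powr_pos)
    show "\<forall>\<^sub>F x in nhds z. x powr p = \<bar>x\<bar> powr p"
      using eventually_nhds_in_open[of "{0<..}" z] that by (auto elim: eventually_mono)
  qed
  consider "z > 0" | "z = 0" | "z < 0" by linarith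
  then show ?thesis
  proof cases
    case 1
    then show ?thesis by (rule pos)
  next
    case 2
    have "((\<lambda>h. \<bar>h\<bar> powr (p - 1)) \<longlongrightarrow> \<bar>0\<bar> powr (p - 1)) (at (0::real))"
      using assms by (intro tendsto_powr' tendsto_intros) auto
    then have "((\<lambda>h. \<bar>h\<bar> powr (p - 1)) \<longlongrightarrow> 0) (at (0::real))" by simp
    then have "((\<lambda>h. (\<bar>0 + h\<bar> powr p - \<bar>0\<bar> powr p) / h) \<longlongrightarrow> 0) (at (0::real))"
    proof (rule Lim_null_comparison[rotated])
      have "norm ((\<bar>0 + h\<bar> powr p - \<bar>0\<bar> powr p) / h) \<le> \<bar>h\<bar> powr (p - 1)" if "h \<noteq> 0" for h :: real
        using that by (simp add: powr_diff)
      then show "\<forall>\<^sub>F h in at 0. norm ((\<bar>0 + h\<bar> powr p - \<bar>0\<bar> powr p) / h) \<le> \<bar>h\<bar> powr (p - 1)"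
        by (simp add: eventually_at_filter)
    qed
    then show ?thesis unfolding DERIV_def 2 by simp
  next
    case 3
    have "((\<lambda>z. \<bar>- z\<bar> powr p) has_real_derivative p * signed_powr (- z) (p - 1) * - 1) (at z)"
      using 3 by (intro DERIV_chain2[OF pos]) (auto intro!: derivative_eq_intros)
    then show ?thesis by (simp add: signed_powr_minus)
  qed
qed

text \<open>The integral of (1 - s powr q) powr (-1/q) over {0..y}, after substituting t = s powr q; this
  form is an incomplete Beta integral.\<close>
definition arcsin_q :: "real \<Rightarrow> real \<Rightarrow> real"
  where "arcsin_q q y =
    integral {0..y powr q} (\<lambda>t. t powr (1 / q - 1) * (1 - t) powr (- 1 / q)) / q"

section \<open>The arc sine as an incomplete Beta integral\<close>

context
  fixes q :: real
  assumes q: "q > 1"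
begin

private abbreviation (input) kernel :: "real \<Rightarrow> real"
  where "kernel t \<equiv> t powr (1 / q - 1) * (1 - t) powr (- 1 / q)"

private lemma kernel_has_integral: "(kernel has_integral Beta (1 / q) (1 - 1 / q)) {0..1}"
  using has_integral_Beta_real[of "1 / q" "1 - 1 / q"] q by simp

text \<open>The two arguments add up to 1, so Beta is Gamma (1/q) Gamma (1 - 1/q), and Euler's
  reflection formula, taken over the complex numbers, yields the sine in
  \<open>pi_q\<close>.\<close>

lemma Beta_pi_q: "Beta (1 / q) (1 - 1 / q) = q * pi_q q / 2"
proof -
  have "complex_of_real (Gamma (1 / q) * Gamma (1 - 1 / q)) =
      Gamma (of_real (1 / q)) * Gamma (1 - of_real (1 / q))"
    unfolding of_real_mult Gamma_complex_of_real[symmetric] by simp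
  also have "\<dots> = of_real pi / sin (of_real pi * of_real (1 / q))"
    by (rule Gamma_reflection_complex)
  also have "\<dots> = of_real (pi / sin (pi / q))"
    by (simp add: sin_of_real[symmetric] del: sin_of_real)
  finally have "Gamma (1 / q) * Gamma (1 - 1 / q) = pi / sin (pi / q)"
    by (simp only: of_real_eq_iff)
  then show ?thesis using q by (simp add: Beta_def pi_q_def)
qed

lemma arcsin_q_0: "arcsin_q q 0 = 0"
  by (simp add: arcsin_q_def)

lemma arcsin_q_1: "arcsin_q q 1 = pi_q q / 2"
proof -
  have "arcsin_q q 1 = Beta (1 / q) (1 - 1 / q) / q"
    unfolding arcsin_q_def by (simp only: powr_one_eq_one integral_unique[OF kernel_has_integral])
  also have "\<dots> = pi_q q / 2"
    unfolding Beta_pi_q using q by (simp add: field_simps)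
  finally show ?thesis .
qed

text \<open>The kernel is singular at both ends but integrable, so its indefinite integral is
  continuous up to them.\<close>

lemma continuous_on_arcsin_q: "continuous_on {0..1} (arcsin_q q)"
proof -
  have "continuous_on {0..1} (\<lambda>x. integral {0..x} kernel)"
    using kernel_has_integral by (intro indefinite_integral_continuous_1) auto
  then have "continuous_on {0..1} (\<lambda>y. integral {0..y powr q} kernel)"
  proof (rule continuous_on_compose2)
    show "continuous_on {0..1} (\<lambda>y. y powr q)"
      using q by (intro continuous_on_powr' continuous_intros) auto
    have "y powr q \<le> 1 powr q" if "y \<in> {0..1}" for y
      using that q by (intro powr_mono2) auto
    then show "(\<lambda>y. y powr q) ` {0..1} \<subseteq> {0..1}" by auto
  qed
  then show ?thesis unfolding arcsin_q_def using q by (intro continuous_on_divide continuous_on_const) auto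
qed

lemma DERIV_arcsin_q:
  assumes "0 < y" "y < 1"
  shows "(arcsin_q q has_real_derivative (1 - y powr q) powr (- 1 / q)) (at y)"
proof -
  define x where "x = y powr q"
  have x: "0 < x" "x < 1"
    using assms q powr_less_mono2[of q y 1] by (auto simp: x_def)
  have "isCont kernel x"
    using x by (intro isCont_mult continuous_at_within_powr continuous_intros) auto
  then have "((\<lambda>u. integral {0..u} kernel) has_vector_derivative kernel x) (at x within {0..1} - {})"
    using kernel_has_integral x
    by (intro integral_has_vector_derivative_continuous_at)
       (auto intro: continuous_at_imp_continuous_within)
  then have "((\<lambda>u. integral {0..u} kernel) has_real_derivative kernel x) (at x)"
    using x at_within_Icc_at[of 0 x 1] by (simp add: has_real_derivative_iff_has_vector_derivative)
  moreover have "((\<lambda>y. y powr q) has_real_derivative q * y powr (q - 1)) (at y)"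
    using assms by (auto intro!: derivative_eq_intros)
  ultimately have "((\<lambda>y. integral {0..y powr q} kernel) has_real_derivative
      kernel x * (q * y powr (q - 1))) (at y)"
    unfolding x_def by (rule DERIV_chain2)
  then have "(arcsin_q q has_real_derivative kernel x * (q * y powr (q - 1)) / q) (at y)"
    unfolding arcsin_q_def by (rule DERIV_cdivide)
  moreover have "kernel x * (q * y powr (q - 1)) / q = (1 - y powr q) powr (- 1 / q)"
  proof -
    \<comment> \<open>The exponents of y cancel: q (1/q - 1) + (q - 1) = 0.\<close>
    have "x powr (1 / q - 1) * y powr (q - 1) = 1"
      using q assms by (simp add: x_def powr_powr powr_add[symmetric] algebra_simps)
    then show ?thesis using q by (simp add: x_def mult_ac)
  qed
  ultimately show ?thesis by simp
qed

lemma arcsin_q_strict_mono: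
  assumes "0 \<le> y" "y < z" "z \<le> 1"
  shows "arcsin_q q y < arcsin_q q z"
proof (rule DERIV_pos_imp_increasing_open[OF assms(2)])
  fix x assume x: "y < x" "x < z"
  then have "x powr q < 1" using powr_less_mono2[of q x 1] assms q by auto
  then show "\<exists>d. (arcsin_q q has_real_derivative d) (at x) \<and> d > 0"
    using DERIV_arcsin_q[of x] x assms by (intro exI conjI) auto
next
  show "continuous_on {y..z} (arcsin_q q)"
    using continuous_on_subset[OF continuous_on_arcsin_q, of "{y..z}"] assms by auto
qed

text \<open>Injectivity takes the place of an inverse function: values of solutions are compared
  through their arc sines.\<close>

lemma arcsin_q_eq_iff:
  "0 \<le> y \<Longrightarrow> y \<le> 1 \<Longrightarrow> 0 \<le> z \<Longrightarrow> z \<le> 1 \<Longrightarrow> arcsin_q q y = arcsin_q q z \<longleftrightarrow> y = z"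
  using arcsin_q_strict_mono[of y z] arcsin_q_strict_mono[of z y]
  by (cases y z rule: linorder_cases) auto

end

section \<open>Oscillation of the q-sine functions\<close>

lemma pi_q_pos:
  assumes "q > 1"
  shows "pi_q q > 0"
proof -
  have "sin (pi / q) > 0"
    using assms by (intro sin_gt_zero) (auto simp: divide_less_eq)
  then show ?thesis using assms by (simp add: pi_q_def)
qed

text \<open>Only the modulus of the initial slope is prescribed. This makes the locale stable under
  v -> -v, so a negative arc of v is a positive arc of its reflection.\<close>

locale q_oscillation =
  fixes q c :: real and v v' :: "real \<Rightarrow> real"
  assumes q: "q > 1" and c: "c > 0"
    and sol: "q_laplace_solution q (c powr q) v v'"
    and initial: "\<bar>v' 0\<bar> = c"
begin

lemma v_deriv: "0 \<le> x \<Longrightarrow> x \<le> 1 \<Longrightarrow> (v has_real_derivative v' x) (at x within {0..1})"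
  and w_deriv: "0 \<le> x \<Longrightarrow> x \<le> 1 \<Longrightarrow> ((\<lambda>t. signed_powr (v' t) (q - 1)) has_real_derivative
        - ((q - 1) * (c powr q) * signed_powr (v x) (q - 1))) (at x within {0..1})"
  and v_0: "v 0 = 0" and v_1: "v 1 = 0"
  using sol by (auto simp: q_laplace_solution_def)

lemma continuous_on_v: "continuous_on {0..1} v"
  using v_deriv by (intro DERIV_continuous_on) auto

lemma continuous_on_w: "continuous_on {0..1} (\<lambda>t. signed_powr (v' t) (q - 1))"
  using w_deriv by (intro DERIV_continuous_on) auto

lemma v'_eq: "v' x = signed_powr (signed_powr (v' x) (q - 1)) (1 / (q - 1))"
  using q by (simp add: signed_powr_inverse)

text \<open>The equation makes the flux \<open>signed_powr (v' x) (q - 1)\<close> differentiable,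
  hence continuous; the inverse signed power carries continuity over to v'.\<close>

lemma continuous_on_v': "continuous_on {0..1} v'"
proof -
  have "continuous_on {0..1} (\<lambda>x. signed_powr (signed_powr (v' x) (q - 1)) (1 / (q - 1)))"
    using q by (intro continuous_on_compose2[OF continuous_on_signed_powr[of _ UNIV] continuous_on_w]) auto
  then show ?thesis using v'_eq by simp
qed

text \<open>The equation differentiates the flux w = \<open>signed_powr v' (q - 1)\<close>, not v'
  itself. So the kinetic term is written as |w|^p with p = q / (q - 1) conjugate to q, which equals
  |v'|^q and can be differentiated by the chain rule.\<close>

lemma energy:
  assumes "0 \<le> x" "x \<le> 1"
  shows "\<bar>v' x\<bar> powr q + c powr q * \<bar>v x\<bar> powr q = c powr q"
proof -
  define w where "w t = signed_powr (v' t) (q - 1)" for t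
  define p where "p = q / (q - 1)"
  have p: "p > 1" using q by (simp add: p_def)
  have v'_w: "\<bar>v' t\<bar> powr q = \<bar>w t\<bar> powr p" for t
    using q by (simp add: w_def p_def signed_powr_sgn abs_mult abs_sgn_eq powr_powr)
  have w_v': "signed_powr (w t) (p - 1) = v' t" for t
  proof -
    have "p - 1 = 1 / (q - 1)" using q by (simp add: p_def field_simps)
    then show ?thesis using v'_eq[of t] by (simp add: w_def)
  qed
  define E where "E t = \<bar>w t\<bar> powr p + c powr q * \<bar>v t\<bar> powr q" for t
  have "(E has_real_derivative 0) (at t within {0..1})" if t: "t \<in> {0..1}" for t
  proof -
    have "((\<lambda>t. \<bar>w t\<bar> powr p) has_real_derivative
        p * signed_powr (w t) (p - 1) * - ((q - 1) * (c powr q) * signed_powr (v t) (q - 1)))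
        (at t within {0..1})"
      unfolding w_def by (rule DERIV_chain2[OF DERIV_abs_powr[OF p] w_deriv]) (use t in auto)
    moreover have "((\<lambda>t. \<bar>v t\<bar> powr q) has_real_derivative q * signed_powr (v t) (q - 1) * v' t)
        (at t within {0..1})"
      by (rule DERIV_chain2[OF DERIV_abs_powr[OF q] v_deriv]) (use t in auto)
    ultimately have "(E has_real_derivative
        p * signed_powr (w t) (p - 1) * - ((q - 1) * (c powr q) * signed_powr (v t) (q - 1)) +
        c powr q * (q * signed_powr (v t) (q - 1) * v' t)) (at t within {0..1})"
      unfolding E_def by (intro DERIV_add DERIV_cmult)
    moreover have "p * signed_powr (w t) (p - 1) * - ((q - 1) * (c powr q) * signed_powr (v t) (q - 1)) +
        c powr q * (q * signed_powr (v t) (q - 1) * v' t) = 0"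
    proof -
      \<comment> \<open>Conjugacy of the exponents is exactly what makes the two terms
        cancel.\<close>
      have pq: "p * (q - 1) = q" using q by (simp add: p_def)
      have "p * v' t * - ((q - 1) * (c powr q) * signed_powr (v t) (q - 1)) =
          - (p * (q - 1) * (v' t * (c powr q) * signed_powr (v t) (q - 1)))"
        by (simp only: mult_ac mult_minus_right)
      then have *: "p * v' t * - ((q - 1) * (c powr q) * signed_powr (v t) (q - 1)) =
          - (q * (v' t * (c powr q) * signed_powr (v t) (q - 1)))"
        unfolding pq .
      show ?thesis unfolding w_v' * by simp
    qed
    ultimately show ?thesis by (rule DERIV_cong)
  qed
  then obtain k where "\<And>t. t \<in> {0..1} \<Longrightarrow> E t = k"
    using has_field_derivative_zero_constant[of "{0..1}" E] by (metis convex_real_interval(5))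
  then have "E x = E 0" using assms by simp
  moreover have "E 0 = c powr q"
    using initial by (simp add: E_def v'_w[symmetric] v_0)
  ultimately show ?thesis by (simp add: E_def v'_w)
qed

lemma abs_v'_le: "0 \<le> x \<Longrightarrow> x \<le> 1 \<Longrightarrow> \<bar>v' x\<bar> \<le> c"
proof -
  assume "0 \<le> x" "x \<le> 1"
  moreover have "0 \<le> c powr q * \<bar>v x\<bar> powr q" by simp
  ultimately have "\<bar>v' x\<bar> powr q \<le> c powr q" using energy[of x] by linarith
  then show ?thesis using powr_less_mono2[of q c "\<bar>v' x\<bar>"] q c by linarith
qed

text \<open>The energy identity solved for v' is a separable first-order equation;
  \<open>arcsin_q\<close> is the function that integrates it.\<close>

lemma abs_v'_eq:
  assumes "0 \<le> x" "x \<le> 1"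
  shows "\<bar>v x\<bar> \<le> 1" "\<bar>v' x\<bar> = c * (1 - \<bar>v x\<bar> powr q) powr (1 / q)"
proof -
  have *: "\<bar>v' x\<bar> powr q = c powr q * (1 - \<bar>v x\<bar> powr q)"
    using energy[OF assms] by (simp add: algebra_simps)
  then have nn: "1 - \<bar>v x\<bar> powr q \<ge> 0"
    using c by (metis powr_ge_zero powr_gt_zero less_irrefl zero_le_mult_iff not_le)
  then show "\<bar>v x\<bar> \<le> 1"
    using q powr_less_mono2[of q 1 "\<bar>v x\<bar>"] by (auto simp: not_le[symmetric])
  have "\<bar>v' x\<bar> = (\<bar>v' x\<bar> powr q) powr (1 / q)" using q by (simp add: powr_powr)
  also have "\<dots> = c * (1 - \<bar>v x\<bar> powr q) powr (1 / q)"
    unfolding * using nn c q by (simp add: powr_mult powr_powr)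
  finally show "\<bar>v' x\<bar> = c * (1 - \<bar>v x\<bar> powr q) powr (1 / q)" .
qed

text \<open>On an arc between consecutive zeros v is strictly concave, hence has a single critical point
  c0, and by energy conservation arcsin_q (v x) has slope c before and -c after c0. So c0 is the
  midpoint and the arc is determined, without any uniqueness theorem for the (non-Lipschitz)
  initial value problem.\<close>
lemma positive_arc:
  assumes x0: "0 \<le> x0" "x0 < 1" "v x0 = 0" "v' x0 > 0"
  shows "x0 + pi_q q / c \<le> 1" "v (x0 + pi_q q / c) = 0" "v' (x0 + pi_q q / c) < 0"
    and "\<And>t. 0 \<le> t \<Longrightarrow> t \<le> pi_q q / c \<Longrightarrow> 0 \<le> v (x0 + t) \<and> v (x0 + t) \<le> 1 \<and>
      arcsin_q q (v (x0 + t)) = c * min t (pi_q q / c - t)"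
proof -
  obtain d where d: "d > 0" "\<And>h. 0 < h \<Longrightarrow> x0 + h \<in> {0..1} \<Longrightarrow> h < d \<Longrightarrow> v x0 < v (x0 + h)"
    using has_real_derivative_pos_inc_right[OF v_deriv[of x0] x0(4)] x0 by auto
  \<comment> \<open>Halving keeps e strictly below d, and the cap keeps \<open>x0 + e\<close> inside
    [0, 1].\<close>
  define e where "e = min (d / 2) (1 - x0)"
  have e: "0 < e" "e < d" "x0 + e \<le> 1" using d(1) x0 by (auto simp: e_def)
  have near: "v x > 0" if "x0 < x" "x \<le> x0 + e" for x
    using d(2)[of "x - x0"] that x0 e by auto
  \<comment> \<open>Starting at \<open>x0 + e\<close> keeps Z closed while excluding the zero at x0,
    so its least element is the next zero. Z is nonempty because of the boundary condition at
    1.\<close>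
  define Z where "Z = {x \<in> {x0 + e..1}. v x = 0}"
  have "closed Z"
    unfolding Z_def using x0 e
    by (intro continuous_closed_preimage_constant continuous_on_subset[OF continuous_on_v]) auto
  moreover have "bounded Z" by (rule bounded_subset[of "{x0 + e..1}"]) (auto simp: Z_def)
  ultimately have "compact Z" by (simp add: compact_eq_bounded_closed)
  moreover have "1 \<in> Z" using e by (auto simp: Z_def v_1)
  ultimately obtain z where z: "z \<in> Z" "\<And>x. x \<in> Z \<Longrightarrow> z \<le> x"
    using compact_attains_inf[of Z] by blast
  have z0: "x0 + e < z" "z \<le> 1" "v z = 0"
    using z(1) near[of "x0 + e"] e by (auto simp: Z_def order_le_less)
  have pos: "v x > 0" if x: "x0 < x" "x < z" for x
  proof (cases "x \<le> x0 + e")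
    case False
    show ?thesis
    proof (rule ccontr)
      assume "\<not> ?thesis"
      moreover have "continuous_on {x0 + e..x} v"
        using continuous_on_subset[OF continuous_on_v] x0 e x z0 by auto
      ultimately obtain y where "x0 + e \<le> y" "y \<le> x" "v y = 0"
        using IVT2'[of v x 0 "x0 + e"] near[of "x0 + e"] e False by auto
      then show False using z(2)[of y] x z0 by (auto simp: Z_def)
    qed
  qed (use near x in auto)
  have interior: "at x within {0..1} = at x" if "x0 < x" "x < z" for x
    using that x0 z0 by (intro at_within_interior) auto
  \<comment> \<open>Where v > 0 the equation gives the flux a negative derivative, and signed powers
    are strictly increasing.\<close>
  have decr: "v' y < v' x" if "x0 \<le> x" "x < y" "y \<le> z" for x y
  proof -
    have "signed_powr (v' y) (q - 1) < signed_powr (v' x) (q - 1)"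
    proof (rule DERIV_neg_imp_decreasing_open[OF that(2)])
      fix t assume t: "x < t" "t < y"
      then have "v t > 0" using pos that by auto
      then have "(q - 1) * (c powr q) * signed_powr (v t) (q - 1) > 0"
        using q c by (intro mult_pos_pos) (auto simp: signed_powr_pos)
      then show "\<exists>l. ((\<lambda>t. signed_powr (v' t) (q - 1)) has_real_derivative l) (at t) \<and> l < 0"
        using w_deriv[of t] interior[of t] t that x0 z0 by (auto intro!: exI)
    next
      show "continuous_on {x..y} (\<lambda>t. signed_powr (v' t) (q - 1))"
        using that x0 z0 by (intro continuous_on_subset[OF continuous_on_w]) auto
    qed
    then show ?thesis using q by (simp add: signed_powr_less_iff)
  qed
  have v_at: "(v has_real_derivative v' x) (at x)" if "x0 < x" "x < z" for x
    using v_deriv[of x] interior[OF that] that x0 z0 by auto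
  have contv: "continuous_on {a..b} v" if "x0 \<le> a" "b \<le> z" for a b
    using that x0 z0 by (intro continuous_on_subset[OF continuous_on_v]) auto
  obtain c0 where c0: "x0 < c0" "c0 < z" "v' c0 = 0"
  proof -
    have "\<exists>y>x0. y < z \<and> DERIV v y :> 0"
    proof (rule Rolle)
      show "x0 < z" "v x0 = v z" using z0 e x0 by auto
      show "v differentiable (at x)" if "x0 < x" "x < z" for x
        using v_at[OF that] real_differentiable_def by blast
    qed (use contv in auto)
    then show ?thesis using that v_at DERIV_unique by blast
  qed
  have range01: "0 \<le> v x \<and> v x \<le> 1" if "x0 \<le> x" "x \<le> z" for x
    using pos[of x] abs_v'_eq(1)[of x] that x0 z0 by (cases "x = x0 \<or> x = z") auto
  \<comment> \<open>At a critical point the energy identity leaves no other nonnegative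
    value.\<close>
  have vc0: "v c0 = 1"
  proof (rule ccontr)
    assume "v c0 \<noteq> 1"
    then have "v c0 powr q < 1" using range01[of c0] c0 powr_less_mono2[of q "v c0" 1] q by auto
    then have "\<bar>v' c0\<bar> > 0"
      using abs_v'_eq(2)[of c0] range01[of c0] c0 x0 z0 c by auto
    then show False using c0 by simp
  qed
  \<comment> \<open>The point c0 is left out because v is 1 there, the end of the range where
    \<open>arcsin_q\<close> has been differentiated; continuity bridges it below.\<close>
  have G_deriv: "((\<lambda>x. arcsin_q q (v x)) has_real_derivative sgn (v' x) * c) (at x)"
    if x: "x0 < x" "x < z" "x \<noteq> c0" for x
  proof -
    have v'0: "v' x \<noteq> 0" using decr[of x c0] decr[of c0 x] x c0 by (cases "x < c0") auto
    have "v x \<noteq> 1" using abs_v'_eq(2)[of x] v'0 x x0 z0 q by auto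
    then have v1: "0 < v x" "v x < 1" using pos[of x] range01[of x] x by auto
    then have m: "v x powr q < 1" using powr_less_mono2[of q "v x" 1] q by auto
    have "((\<lambda>x. arcsin_q q (v x)) has_real_derivative (1 - v x powr q) powr (- 1 / q) * v' x) (at x)"
      by (rule DERIV_chain2[OF DERIV_arcsin_q[OF q v1] v_at[OF x(1,2)]])
    moreover have "(1 - v x powr q) powr (- 1 / q) * v' x = sgn (v' x) * c"
    proof -
      have "\<bar>v' x\<bar> = c * (1 - v x powr q) powr (1 / q)"
        using abs_v'_eq(2)[of x] x x0 z0 v1 by simp
      then have "v' x = sgn (v' x) * (c * (1 - v x powr q) powr (1 / q))"
        by (metis sgn_mult_abs)
      then have "(1 - v x powr q) powr (- 1 / q) * v' x =
          (1 - v x powr q) powr (- 1 / q) * (sgn (v' x) * (c * (1 - v x powr q) powr (1 / q)))"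
        by (rule arg_cong)
      also have "\<dots> = sgn (v' x) * c * ((1 - v x powr q) powr (- 1 / q) * (1 - v x powr q) powr (1 / q))"
        by (simp only: mult_ac)
      also have "(1 - v x powr q) powr (- 1 / q) * (1 - v x powr q) powr (1 / q) = 1"
        using m by (simp add: powr_add[symmetric])
      finally show ?thesis by simp
    qed
    ultimately show ?thesis by (rule DERIV_cong)
  qed
  have contG: "continuous_on {a..b} (\<lambda>x. arcsin_q q (v x))" if "x0 \<le> a" "b \<le> z" for a b
    using range01 that
    by (intro continuous_on_compose2[OF continuous_on_arcsin_q[OF q] contv[OF that]]) auto
  have left: "arcsin_q q (v x) = c * (x - x0)" if x: "x0 \<le> x" "x \<le> c0" for x
  proof -
    have "arcsin_q q (v x) - c * x = arcsin_q q (v x0) - c * x0"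
    proof (rule DERIV_isconst2[OF c0(1) _ _ x])
      show "continuous_on {x0..c0} (\<lambda>x. arcsin_q q (v x) - c * x)"
        using c0 by (intro continuous_intros contG) auto
      fix y assume y: "x0 < y" "y < c0"
      then have "sgn (v' y) = 1" using decr[of y c0] c0 by auto
      then show "((\<lambda>x. arcsin_q q (v x) - c * x) has_real_derivative 0) (at y)"
        using G_deriv[of y] y c0 by (auto intro!: derivative_eq_intros)
    qed
    then show ?thesis using x0 arcsin_q_0[OF q] by (simp add: algebra_simps)
  qed
  have right: "arcsin_q q (v x) = arcsin_q q (v c0) + c * c0 - c * x" if x: "c0 \<le> x" "x \<le> z" for x
  proof -
    have "arcsin_q q (v x) + c * x = arcsin_q q (v c0) + c * c0"
    proof (rule DERIV_isconst2[OF c0(2) _ _ x])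
      show "continuous_on {c0..z} (\<lambda>x. arcsin_q q (v x) + c * x)"
        using c0 by (intro continuous_intros contG) auto
      fix y assume y: "c0 < y" "y < z"
      then have "sgn (v' y) = -1" using decr[of c0 y] c0 by auto
      then show "((\<lambda>x. arcsin_q q (v x) + c * x) has_real_derivative 0) (at y)"
        using G_deriv[of y] y c0 by (auto intro!: derivative_eq_intros)
    qed
    then show ?thesis by simp
  qed
  \<comment> \<open>On each side of c0 the arc sine covers the range from 0 to
    \<open>arcsin_q q 1\<close> with slope of modulus c, which fixes both half lengths.\<close>
  have half: "c * (c0 - x0) = pi_q q / 2" using left[of c0] c0 vc0 arcsin_q_1[OF q] by simp
  then have c0_eq: "c0 = x0 + pi_q q / c / 2" using c by (simp add: field_simps)
  have "c * z = pi_q q / 2 + c * c0"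
    using right[of z] c0 z0 vc0 arcsin_q_0[OF q] arcsin_q_1[OF q] by simp
  then have "c * z = pi_q q + c * x0" using half by (simp add: right_diff_distrib)
  then have z_eq: "z = x0 + pi_q q / c" using c by (simp add: field_simps)
  show "x0 + pi_q q / c \<le> 1" "v (x0 + pi_q q / c) = 0" using z0 z_eq by auto
  show "v' (x0 + pi_q q / c) < 0" using decr[of c0 z] c0 z_eq by auto
  fix t assume t: "0 \<le> t" "t \<le> pi_q q / c"
  have "arcsin_q q (v (x0 + t)) = c * min t (pi_q q / c - t)"
  proof (cases "t \<le> pi_q q / c / 2")
    case True
    then have "min t (pi_q q / c - t) = t" by (simp add: min_def)
    then show ?thesis using left[of "x0 + t"] True t c0_eq by simp
  next
    case False
    then have "min t (pi_q q / c - t) = pi_q q / c - t" by (simp add: min_def)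
    moreover have "arcsin_q q (v (x0 + t)) = c * (z - (x0 + t))"
    proof -
      have "c0 \<le> x0 + t" "x0 + t \<le> z" "c0 \<le> z" "z \<le> z" using False t c0_eq z_eq c0 by auto
      then have "arcsin_q q (v (x0 + t)) - arcsin_q q (v z) = c * z - c * (x0 + t)"
        using right[of "x0 + t"] right[of z] by linarith
      then show ?thesis using z0(3) arcsin_q_0[OF q] by (simp only: right_diff_distrib)
    qed
    ultimately show ?thesis using z_eq by simp
  qed
  then show "0 \<le> v (x0 + t) \<and> v (x0 + t) \<le> 1 \<and>
      arcsin_q q (v (x0 + t)) = c * min t (pi_q q / c - t)"
    using range01[of "x0 + t"] t z_eq by auto
qed

lemma reflected: "q_oscillation q c (\<lambda>x. - v x) (\<lambda>x. - v' x)"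
proof
  show "q_laplace_solution q (c powr q) (\<lambda>x. - v x) (\<lambda>x. - v' x)"
    unfolding q_laplace_solution_def
  proof (intro conjI ballI)
    fix x :: real assume "x \<in> {0..1}"
    then show "((\<lambda>x. - v x) has_real_derivative - v' x) (at x within {0..1})"
      and "((\<lambda>t. signed_powr (- v' t) (q - 1)) has_real_derivative
        - ((q - 1) * (c powr q) * signed_powr (- v x) (q - 1))) (at x within {0..1})"
      using DERIV_minus[OF v_deriv[of x]] DERIV_minus[OF w_deriv[of x]]
      by (auto simp: signed_powr_minus)
  qed (use v_0 v_1 in auto)
qed (use q c initial in auto)

text \<open>Each arc ends in a zero with slope of the opposite sign, so the next one is a positive
  arc of v or of -v. For c = n pi_q an arc has length 1/n, and n of them tile [0, 1]. In the local
  parameter t the arc sine formula mentions neither n nor j.\<close>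

lemma alternating_arcs:
  assumes n: "c = real n * pi_q q" and v'0: "v' 0 > 0"
  shows "j \<le> n \<Longrightarrow> v (real j / real n) = 0 \<and> (- 1) ^ j * v' (real j / real n) > 0"
    and "j < n \<Longrightarrow> 0 \<le> t \<Longrightarrow> t \<le> 1 \<Longrightarrow>
      0 \<le> (- 1) ^ j * v ((real j + t) / real n) \<and> (- 1) ^ j * v ((real j + t) / real n) \<le> 1 \<and>
      arcsin_q q ((- 1) ^ j * v ((real j + t) / real n)) = pi_q q * min t (1 - t)"
proof -
  have n0: "n > 0" using c n by (cases n) auto
  have pc: "pi_q q / c = 1 / real n" using n pi_q_pos[OF q] by simp
  interpret m: q_oscillation q c "\<lambda>x. - v x" "\<lambda>x. - v' x" by (rule reflected)
  show zeros: "v (real j / real n) = 0 \<and> (- 1) ^ j * v' (real j / real n) > 0" if "j \<le> n" for j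
    using that
  proof (induction j)
    case 0
    then show ?case using v_0 v'0 by simp
  next
    case (Suc j)
    then have IH: "v (real j / real n) = 0" "(- 1) ^ j * v' (real j / real n) > 0" by auto
    have j: "0 \<le> real j / real n" "real j / real n < 1" using Suc.prems n0 by auto
    have next_zero: "real j / real n + pi_q q / c = real (Suc j) / real n"
      unfolding pc by (simp add: add_divide_distrib)
    show ?case
    proof (cases "even j")
      case True
      then show ?thesis
        using positive_arc(2,3)[OF j IH(1)] IH(2) next_zero by simp
    next
      case False
      then show ?thesis
        using m.positive_arc(2,3)[OF j] IH next_zero by simp
    qed
  qed
  assume "j < n" and t: "0 \<le> t" "t \<le> 1"
  then have j: "0 \<le> real j / real n" "real j / real n < 1" using n0 by auto
  have Z: "v (real j / real n) = 0" "(- 1) ^ j * v' (real j / real n) > 0"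
    using zeros[of j] \<open>j < n\<close> by auto
  have tn: "0 \<le> t / real n" "t / real n \<le> pi_q q / c"
    using t n0 by (auto simp: pc divide_right_mono)
  have arg: "(real j + t) / real n = real j / real n + t / real n" by (simp add: add_divide_distrib)
  have "pi_q q / c - t / real n = (1 - t) / real n" unfolding pc by (simp add: diff_divide_distrib)
  then have mn: "c * min (t / real n) (pi_q q / c - t / real n) = pi_q q * min t (1 - t)"
    using n0 by (simp add: n min_def divide_le_cancel)
  show "0 \<le> (- 1) ^ j * v ((real j + t) / real n) \<and> (- 1) ^ j * v ((real j + t) / real n) \<le> 1 \<and>
      arcsin_q q ((- 1) ^ j * v ((real j + t) / real n)) = pi_q q * min t (1 - t)"
  proof (cases "even j")
    case True
    then show ?thesis
      using positive_arc(4)[OF j Z(1) _ tn] Z(2) mn by (simp add: arg)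
  next
    case False
    then show ?thesis
      using m.positive_arc(4)[OF j _ _ tn] Z mn by (simp add: arg)
  qed
qed

end

lemma q_sine_oscillation:
  assumes "q > 1" "n \<ge> 1" "q_sine q n u"
  obtains u' where "q_oscillation q (real n * pi_q q) u u'" "u' 0 > 0"
proof -
  obtain u' where u': "q_laplace_solution q ((real n * pi_q q) powr q) u u'" "u' 0 = real n * pi_q q"
    using assms(3) by (auto simp: q_sine_def)
  have "real n * pi_q q > 0" using pi_q_pos[OF assms(1)] assms(2) by simp
  with u' assms(1) that show ?thesis by (auto simp: q_oscillation_def)
qed

text \<open>The arc sine of \<open>u t\<close> is \<open>pi_q q * min t (1 - t)\<close>, which is
  invariant under t -> 1 - t.\<close>

lemma q_sine_one_symmetric:
  assumes "q > 1" "q_sine q 1 u" "0 \<le> t" "t \<le> 1"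
  shows "u (1 - t) = u t"
proof -
  obtain u' where u': "q_oscillation q (real 1 * pi_q q) u u'" "u' 0 > 0"
    using q_sine_oscillation[OF assms(1) _ assms(2)] by auto
  show ?thesis
    using q_oscillation.alternating_arcs(2)[OF u'(1) refl u'(2), of 0 t]
      q_oscillation.alternating_arcs(2)[OF u'(1) refl u'(2), of 0 "1 - t"] assms(3,4)
      arcsin_q_eq_iff[OF assms(1), of "u (1 - t)" "u t"]
    by (simp add: min.commute)
qed

text \<open>Up to sign, every arc of v has the same arc sine in the local parameter t as the single
  arc of u. This is f n (x) = f 1 (n x) with the periodic extension of f 1 spelled out arc by
  arc.\<close>

lemma q_sine_dilation:
  assumes "q > 1" "q_sine q 1 u" "q_sine q n v" "j < n" "0 \<le> t" "t \<le> 1"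
  shows "v ((real j + t) / real n) = (- 1) ^ j * u t"
proof -
  obtain u' where u': "q_oscillation q (real 1 * pi_q q) u u'" "u' 0 > 0"
    using q_sine_oscillation[OF assms(1) _ assms(2)] by auto
  obtain v' where v': "q_oscillation q (real n * pi_q q) v v'" "v' 0 > 0"
    using q_sine_oscillation[OF assms(1) _ assms(3)] assms(4) by auto
  have "(- 1) ^ j * v ((real j + t) / real n) = u t"
    using q_oscillation.alternating_arcs(2)[OF v'(1) refl v'(2) assms(4-6)]
      q_oscillation.alternating_arcs(2)[OF u'(1) refl u'(2), of 0 t] assms(5,6)
      arcsin_q_eq_iff[OF assms(1), of "(- 1) ^ j * v ((real j + t) / real n)" "u t"]
    by simp
  then show ?thesis by (cases "even j") auto
qed

section \<open>Sine coefficients\<close>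

text \<open>Grouping the terms of sum 1/n^2 in pairs splits it into the odd squares and a quarter of
  itself, so the odd part is (1 - 1/4) pi^2 / 6.\<close>

lemma sum_inverse_odd_squares_le:
  assumes "finite A" "\<And>k. k \<in> A \<Longrightarrow> odd k"
  shows "(\<Sum>k\<in>A. 1 / (real k)\<^sup>2) \<le> pi\<^sup>2 / 8"
proof -
  let ?f = "\<lambda>n::nat. 1 / (real n + 1)\<^sup>2"
  have 1: "?f sums (pi\<^sup>2 / 6)"
    using inverse_squares_sums by (simp add: add.commute)
  have "(\<lambda>n. sum ?f {n * 2..<n * 2 + 2}) sums (pi\<^sup>2 / 6)"
    by (rule sums_group[OF 1]) simp
  moreover have "sum ?f {n * 2..<n * 2 + 2} = 1 / (2 * real n + 1)\<^sup>2 + (1/4) * ?f n" for n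
  proof -
    have "{n * 2..<n * 2 + 2} = {2 * n, 2 * n + 1}" by auto
    moreover have "(real (2 * n + 1) + 1)\<^sup>2 = 4 * (real n + 1)\<^sup>2"
      by (simp add: power2_eq_square algebra_simps)
    ultimately show ?thesis by simp
  qed
  ultimately have "(\<lambda>n. 1 / (2 * real n + 1)\<^sup>2 + (1/4) * ?f n) sums (pi\<^sup>2 / 6)" by simp
  from sums_diff[OF this sums_mult[OF 1, of "1/4"]]
  have odd_sums: "(\<lambda>n. 1 / (2 * real n + 1)\<^sup>2) sums (pi\<^sup>2 / 8)" by simp
  define B where "B = (\<lambda>k. k div 2) ` A"
  have "A = (\<lambda>n. 2 * n + 1) ` B"
    using assms(2) by (auto simp: B_def image_image odd_two_times_div_two_succ intro!: image_eqI)
  moreover have "inj_on (\<lambda>n::nat. 2 * n + 1) B" by (auto simp: inj_on_def)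
  ultimately have "(\<Sum>k\<in>A. 1 / (real k)\<^sup>2) = (\<Sum>n\<in>B. 1 / (2 * real n + 1)\<^sup>2)"
    by (simp add: sum.reindex add.commute)
  also have "\<dots> \<le> (\<Sum>n. 1 / (2 * real n + 1)\<^sup>2)"
    using odd_sums assms(1) by (intro sum_le_suminf) (auto simp: B_def sums_iff)
  also have "\<dots> = pi\<^sup>2 / 8" using odd_sums by (simp add: sums_iff)
  finally show ?thesis .
qed

lemma norm_to_L2_le:
  assumes "continuous_on {0..1} u" "\<And>x. 0 \<le> x \<Longrightarrow> x \<le> 1 \<Longrightarrow> \<bar>u x\<bar> \<le> B" "0 \<le> B"
  shows "norm (to_L2 u) \<le> B"
proof -
  have "(norm (to_L2 u))\<^sup>2 = (LINT x|unit_measure. (u x)\<^sup>2)"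
    by (intro norm_to_L2 square_integrable_continuous assms)
  also have "\<dots> = integral {0..1} (\<lambda>x. (u x)\<^sup>2)"
    by (intro LINT_unit_continuous continuous_intros assms)
  also have "\<dots> \<le> integral {0..1} (\<lambda>x::real. B\<^sup>2)"
    using assms
    by (intro integral_le integrable_continuous_real continuous_intros)
       (auto simp: abs_le_square_iff[symmetric])
  also have "\<dots> = B\<^sup>2" by simp
  finally show ?thesis using assms(3) by (simp add: power2_le_iff_abs_le)
qed

section \<open>Sine coefficients of a single oscillation\<close>

context q_oscillation
begin

text \<open>The product \<open>v x * (sqrt 2 * cos (real k * pi * x))\<close> vanishes at both ends,
  so its derivative integrates to 0. The gained factor 1/k is what makes the coefficients
  summable.\<close>

lemma sine_coefficient_by_parts:
  "real k * pi * inner (to_L2 v) (sine_basis k) = inner (to_L2 v') (cosine_basis k)"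
proof -
  let ?s = "\<lambda>x. sqrt 2 * sin (real k * pi * x)" and ?c = "\<lambda>x. sqrt 2 * cos (real k * pi * x)"
  have sv: "square_integrable v" "square_integrable v'"
    using continuous_on_v continuous_on_v' by (auto intro: square_integrable_continuous)
  have "(LINT x|unit_measure. v' x * ?c x - (real k * pi) * (v x * ?s x)) = v 1 * ?c 1 - v 0 * ?c 0"
  proof (rule LINT_unit_FTC)
    show "continuous_on {0..1} (\<lambda>x. v' x * ?c x - (real k * pi) * (v x * ?s x))"
      by (intro continuous_intros continuous_on_v continuous_on_v')
    fix x :: real assume "0 \<le> x" "x \<le> 1"
    from v_deriv[OF this]
    show "((\<lambda>x. v x * ?c x) has_real_derivative v' x * ?c x - (real k * pi) * (v x * ?s x))
        (at x within {0..1})"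
      by (auto intro!: derivative_eq_intros)
  qed
  moreover have "(LINT x|unit_measure. v' x * ?c x - (real k * pi) * (v x * ?s x)) =
      (LINT x|unit_measure. v' x * ?c x) - (real k * pi) * (LINT x|unit_measure. v x * ?s x)"
    using sv square_integrable_mult[OF sv(2) square_integrable_cosine]
      square_integrable_mult[OF sv(1) square_integrable_sine]
    by (subst Bochner_Integration.integral_diff) (auto intro: integrable_mult_right)
  ultimately show ?thesis
    using sv by (simp add: sine_basis_def cosine_basis_def inner_to_L2 square_integrable_sine
        square_integrable_cosine v_0 v_1)
qed

text \<open>For even k the sine is odd about 1/2 while v is even about it, so reflection turns the
  integral into its negative.\<close>

lemma even_sine_coefficient_zero:
  assumes sym: "\<And>t. 0 \<le> t \<Longrightarrow> t \<le> 1 \<Longrightarrow> v (1 - t) = v t" and "even k"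
  shows "inner (to_L2 v) (sine_basis k) = 0"
proof -
  let ?g = "\<lambda>x. v x * (sqrt 2 * sin (real k * pi * x))"
  have sv: "square_integrable v" using continuous_on_v by (rule square_integrable_continuous)
  have "sin (real k * pi * (1 - x)) = - sin (real k * pi * x)" for x
  proof -
    have "sin (real k * pi * (1 - x)) = sin (real k * pi - real k * pi * x)"
      by (simp add: right_diff_distrib)
    then show ?thesis using \<open>even k\<close> by (simp add: sin_diff)
  qed
  then have *: "?g (1 - x) = - ?g x" if "x \<in> space unit_measure" for x
    using sym[of x] that by (simp add: space_restrict_space)
  have "(LINT x|unit_measure. ?g x) = (LINT x|unit_measure. ?g (1 - x))"
    by (rule LINT_unit_reflect[symmetric]) (intro continuous_intros continuous_on_v)
  also have "\<dots> = (LINT x|unit_measure. - ?g x)"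
    by (intro Bochner_Integration.integral_cong refl *)
  also have "\<dots> = - (LINT x|unit_measure. ?g x)" by simp
  finally have "(LINT x|unit_measure. ?g x) = 0" by simp
  then show ?thesis using sv by (simp add: sine_basis_def inner_to_L2 square_integrable_sine)
qed

lemma sum_abs_sine_coefficients_le:
  assumes sym: "\<And>t. 0 \<le> t \<Longrightarrow> t \<le> 1 \<Longrightarrow> v (1 - t) = v t"
  shows "(\<Sum>k=1..m. \<bar>inner (to_L2 v) (sine_basis k)\<bar>) \<le> c / (2 * sqrt 2)"
proof -
  define A where "A = {k \<in> {1..m}. odd k}"
  let ?b = "\<lambda>k. inner (to_L2 v') (cosine_basis k)"
  have "(\<Sum>k=1..m. \<bar>inner (to_L2 v) (sine_basis k)\<bar>) = (\<Sum>k\<in>A. \<bar>inner (to_L2 v) (sine_basis k)\<bar>)"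
    by (rule sum.mono_neutral_right) (auto simp: A_def even_sine_coefficient_zero[OF sym])
  also have "\<dots> = (\<Sum>k\<in>A. 1 / (real k * pi) * \<bar>?b k\<bar>)"
  proof (rule sum.cong[OF refl])
    fix k assume "k \<in> A"
    then have "k > 0" by (auto simp: A_def odd_pos)
    then show "\<bar>inner (to_L2 v) (sine_basis k)\<bar> = 1 / (real k * pi) * \<bar>?b k\<bar>"
      unfolding sine_coefficient_by_parts[symmetric] by (simp add: abs_mult)
  qed
  finally have eq: "(\<Sum>k=1..m. \<bar>inner (to_L2 v) (sine_basis k)\<bar>) = (\<Sum>k\<in>A. 1 / (real k * pi) * \<bar>?b k\<bar>)" .
  have "(\<Sum>k\<in>A. 1 / (real k * pi) * \<bar>?b k\<bar>)\<^sup>2 \<le> (\<Sum>k\<in>A. (1 / (real k * pi))\<^sup>2) * (\<Sum>k\<in>A. \<bar>?b k\<bar>\<^sup>2)"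
    by (rule Cauchy_Schwarz_ineq_sum)
  \<comment> \<open>The odd squares contribute (pi^2 / 8) / pi^2, and Bessel for the cosines bounds
    the other factor by the squared norm of v', where |v'| is at most c.\<close>
  also have "\<dots> \<le> (1 / 8) * c\<^sup>2"
  proof (rule mult_mono)
    have "(\<Sum>k\<in>A. (1 / (real k * pi))\<^sup>2) = (\<Sum>k\<in>A. 1 / (real k)\<^sup>2) / pi\<^sup>2"
      unfolding sum_divide_distrib by (intro sum.cong) (auto simp: power_divide power_mult_distrib)
    also have "\<dots> \<le> (pi\<^sup>2 / 8) / pi\<^sup>2"
      by (intro divide_right_mono sum_inverse_odd_squares_le) (auto simp: A_def)
    finally show "(\<Sum>k\<in>A. (1 / (real k * pi))\<^sup>2) \<le> 1 / 8" by simp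
    have "(\<Sum>k\<in>A. (?b k)\<^sup>2) \<le> (norm (to_L2 v'))\<^sup>2"
      using inner_cosine_basis by (intro Bessel_inequality) (auto simp: A_def)
    also have "norm (to_L2 v') \<le> c"
      using continuous_on_v' abs_v'_le c by (intro norm_to_L2_le) auto
    then have "(norm (to_L2 v'))\<^sup>2 \<le> c\<^sup>2" by (intro power_mono) auto
    finally show "(\<Sum>k\<in>A. \<bar>?b k\<bar>\<^sup>2) \<le> c\<^sup>2" by simp
  qed (auto intro: sum_nonneg)
  also have "\<dots> = (c / (2 * sqrt 2))\<^sup>2" by (simp add: power_divide power_mult_distrib)
  finally have "(\<Sum>k\<in>A. 1 / (real k * pi) * \<bar>?b k\<bar>) \<le> c / (2 * sqrt 2)"
    by (rule power2_le_imp_le) (use c in simp)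
  then show ?thesis by (simp only: eq)
qed

end

text \<open>Turns the identity of two L2 limits into pointwise equality, which evaluation at n x
  requires.\<close>

lemma continuous_to_L2_inject:
  assumes u: "continuous_on {0..1} u" "continuous_on {0..1} v" and eq: "to_L2 u = to_L2 v"
    and x: "0 \<le> x" "x \<le> 1"
  shows "u x = v x"
proof -
  have si: "square_integrable u" "square_integrable v" using u by (auto intro: square_integrable_continuous)
  have "(LINT x|unit_measure. (u x - v x)\<^sup>2) = (norm (to_L2 u - to_L2 v))\<^sup>2"
    using si by (simp add: to_L2_diff norm_to_L2 square_integrable_diff)
  then have "integral {0..1} (\<lambda>x. (u x - v x)\<^sup>2) = 0"
    using u eq by (subst LINT_unit_continuous[symmetric]) (auto intro!: continuous_intros)
  then have "(u x - v x)\<^sup>2 = 0"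
    using u x by (subst (asm) integral_eq_0_iff) (auto intro!: continuous_intros)
  then show ?thesis by simp
qed

lemma sine_basis_0: "sine_basis 0 = 0"
  by (simp add: sine_basis_def to_L2_zero)

text \<open>Absolute summability gives a continuous sum F on the whole line, which extends f 1.
  Replacing x by n x in its series turns the k-th sine into \<open>sine_basis (k * n)\<close>, so it
  remains to identify f n with F (n x).\<close>

lemma q_sine_expansion:
  assumes q: "q > 1" and f: "\<And>n. n \<ge> 1 \<Longrightarrow> q_sine q n (f n)"
  obtains a where "\<And>m. (\<Sum>k=1..m. \<bar>a k\<bar>) \<le> pi_q q / (2 * sqrt 2)"
    and "\<And>n. n \<ge> 1 \<Longrightarrow> (\<lambda>m. \<Sum>k=1..m. a k *\<^sub>R sine_basis (k * n)) \<longlonglongrightarrow> to_L2 (f n)"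
proof -
  define u where "u = f 1"
  have u: "q_sine q 1 u" using f[of 1] by (simp add: u_def)
  obtain u' where u': "q_oscillation q (real 1 * pi_q q) u u'" "u' 0 > 0"
    using q_sine_oscillation[OF q _ u] by auto
  then interpret q_oscillation q "pi_q q" u u' by simp
  note sym = q_sine_one_symmetric[OF q u]
  define a where "a k = inner (to_L2 u) (sine_basis k)" for k
  have even0: "a k = 0" if "even k" for k
    using even_sine_coefficient_zero[OF sym that] by (simp add: a_def)
  have bound: "(\<Sum>k=1..m. \<bar>a k\<bar>) \<le> pi_q q / (2 * sqrt 2)" for m
    using sum_abs_sine_coefficients_le[OF sym, of m] by (simp add: a_def)
  \<comment> \<open>Series run from 0 but the expansion from 1; the extra term vanishes because
    \<open>sine_basis 0\<close> is 0.\<close>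
  have from_1: "(\<Sum>k<Suc m. g k) = (\<Sum>k=1..m. g k)" if "g 0 = 0" for g :: "nat \<Rightarrow> 'b::comm_monoid_add" and m
    using that by (simp add: sum.lessThan_Suc_shift sum.atLeast1_atMost_eq del: sum.lessThan_Suc)
  have summ: "summable (\<lambda>k. \<bar>a k\<bar>)"
  proof (rule summableI_nonneg_bounded)
    fix m
    have "(\<Sum>k<m. \<bar>a k\<bar>) \<le> (\<Sum>k<Suc m. \<bar>a k\<bar>)" by simp
    also have "\<dots> = (\<Sum>k=1..m. \<bar>a k\<bar>)" by (rule from_1) (simp add: a_def sine_basis_0)
    finally show "(\<Sum>k<m. \<bar>a k\<bar>) \<le> pi_q q / (2 * sqrt 2)" using bound[of m] by simp
  qed simp
  define T where "T k x = a k * (sqrt 2 * sin (real k * pi * x))" for k x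
  define F where "F x = (\<Sum>k. T k x)" for x
  have T_le: "norm (T k x) \<le> sqrt 2 * \<bar>a k\<bar>" for k x
  proof -
    have "\<bar>a k\<bar> * (sqrt 2 * \<bar>sin (real k * pi * x)\<bar>) \<le> \<bar>a k\<bar> * (sqrt 2 * 1)"
      by (intro mult_left_mono) auto
    then show ?thesis by (simp add: T_def abs_mult mult_ac)
  qed
  have sT: "summable (\<lambda>k. sqrt 2 * \<bar>a k\<bar>)" using summ by (rule summable_mult)
  have unif: "uniform_limit UNIV (\<lambda>m x. \<Sum>k<m. T k x) F sequentially"
    unfolding F_def by (rule Weierstrass_m_test[OF T_le sT])
  have cT: "continuous_on S (\<lambda>x. \<Sum>k<m. T k x)" for S m
    unfolding T_def by (intro continuous_intros)
  have cF: "continuous_on S F" for S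
  proof (rule continuous_on_subset[OF uniform_limit_theorem[OF _ unif]])
    show "\<forall>\<^sub>F m in sequentially. continuous_on UNIV (\<lambda>x. \<Sum>k<m. T k x)"
      using cT by (intro always_eventually) auto
  qed auto
  let ?C = "\<Sum>k. sqrt 2 * \<bar>a k\<bar>"
  have dilated: "(\<lambda>m. \<Sum>k=1..m. a k *\<^sub>R sine_basis (k * n)) \<longlonglongrightarrow> to_L2 (\<lambda>x. F (real n * x))" for n
  proof -
    have "(\<lambda>m. to_L2 (\<lambda>x. \<Sum>k<Suc m. T k (real n * x))) \<longlonglongrightarrow> to_L2 (\<lambda>x. F (real n * x))"
    proof (rule to_L2_dominated_tendsto(2)[where w = "\<lambda>x. ?C"])
      fix m
      show "(\<lambda>x. \<Sum>k<Suc m. T k (real n * x)) \<in> borel_measurable unit_measure"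
        by (intro borel_measurable_unit_continuous continuous_on_compose2[OF cT[of UNIV]] continuous_intros) auto
      have "\<bar>\<Sum>k<Suc m. T k x\<bar> \<le> ?C" for x
      proof -
        have "\<bar>\<Sum>k<Suc m. T k x\<bar> \<le> (\<Sum>k<Suc m. sqrt 2 * \<bar>a k\<bar>)"
          using T_le by (intro order_trans[OF sum_abs sum_mono]) auto
        also have "\<dots> \<le> ?C" by (intro sum_le_suminf sT) auto
        finally show ?thesis .
      qed
      then show "AE x in unit_measure. \<bar>\<Sum>k<Suc m. T k (real n * x)\<bar> \<le> ?C" by simp
    next
      show "(\<lambda>x. F (real n * x)) \<in> borel_measurable unit_measure"
        by (intro borel_measurable_unit_continuous continuous_on_compose2[OF cF[of UNIV]] continuous_intros) auto
      show "AE x in unit_measure. (\<lambda>m. \<Sum>k<Suc m. T k (real n * x)) \<longlonglongrightarrow> F (real n * x)"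
        by (intro AE_I2 LIMSEQ_Suc tendsto_uniform_limitI[OF unif]) auto
    qed (rule square_integrable_const)
    moreover have "to_L2 (\<lambda>x. \<Sum>k<Suc m. T k (real n * x)) = (\<Sum>k=1..m. a k *\<^sub>R sine_basis (k * n))" for m
    proof -
      have "to_L2 (\<lambda>x. \<Sum>k<Suc m. T k (real n * x)) =
          to_L2 (\<lambda>x. \<Sum>k<Suc m. a k * (sqrt 2 * sin (real (k * n) * pi * x)))"
        by (simp only: T_def of_nat_mult mult_ac)
      also have "\<dots> = (\<Sum>k<Suc m. a k *\<^sub>R sine_basis (k * n))"
        by (simp only: to_L2_sum[OF finite_lessThan] square_integrable_scale square_integrable_sine
            to_L2_scaleR[symmetric] sine_basis_def)
      also have "\<dots> = (\<Sum>k=1..m. a k *\<^sub>R sine_basis (k * n))"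
        by (rule from_1) (simp add: a_def sine_basis_0)
      finally show ?thesis .
    qed
    ultimately show ?thesis by simp
  qed
  \<comment> \<open>The same partial sums converge in L2 to u by completeness and to F by uniform
    convergence.\<close>
  have "(\<lambda>m. \<Sum>k=1..m. a k *\<^sub>R sine_basis k) \<longlonglongrightarrow> to_L2 u"
    using orthonormal_expansion_tendsto[OF inner_sine_basis closure_sine_span, of "to_L2 u"]
    by (simp add: a_def)
  moreover have "(\<lambda>m. \<Sum>k=1..m. a k *\<^sub>R sine_basis k) \<longlonglongrightarrow> to_L2 F"
    using dilated[of 1] by simp
  ultimately have "to_L2 u = to_L2 F" by (rule LIMSEQ_unique)
  then have uF: "u t = F t" if "0 \<le> t" "t \<le> 1" for t
    using continuous_to_L2_inject[OF continuous_on_v cF] that by blast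
  \<comment> \<open>Only odd frequencies survive, and each of these sines is multiplied by (-1)^j
    under a shift by j.\<close>
  have shift: "F (real j + t) = (- 1) ^ j * F t" for j t
  proof -
    have "T k (real j + t) = (- 1) ^ j * T k t" for k
    proof (cases "even k")
      case False
      have "sin (real k * pi * (real j + t)) = sin (real (k * j) * pi + real k * pi * t)"
        by (simp add: algebra_simps)
      also have "\<dots> = cos (real (k * j) * pi) * sin (real k * pi * t)"
        by (simp only: sin_add sin_npi mult_zero_left add_0_left)
      also have "cos (real (k * j) * pi) = (- 1) ^ (k * j)" by (rule cos_npi)
      also have "(- 1 :: real) ^ (k * j) = (- 1) ^ j" using False by (simp add: power_mult)
      finally show ?thesis by (simp add: T_def)
    qed (simp add: T_def even0)
    moreover have "summable (\<lambda>k. T k t)"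
      by (rule summable_comparison_test'[OF sT T_le])
    ultimately show ?thesis by (simp add: F_def suminf_mult)
  qed
  have "to_L2 (f n) = to_L2 (\<lambda>x. F (real n * x))" if n: "n \<ge> 1" for n
  proof (rule to_L2_cong)
    fix x :: real assume x: "0 < x" "x < 1"
    \<comment> \<open>The point x lies on arc number j of f n, at relative position t.\<close>
    define j where "j = nat \<lfloor>real n * x\<rfloor>"
    define t where "t = real n * x - real j"
    have fl: "real j = of_int \<lfloor>real n * x\<rfloor>" using x by (simp add: j_def)
    then have t: "0 \<le> t" "t \<le> 1" unfolding t_def by linarith+
    have "real j \<le> real n * x" using t by (simp add: t_def)
    also have "real n * x < real n" using x n by simp
    finally have j: "j < n" by simp
    have "x = (real j + t) / real n" using n by (simp add: t_def)
    then have "f n x = (- 1) ^ j * u t"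
      using q_sine_dilation[OF q u f[OF n] j t] by simp
    also have "\<dots> = F (real n * x)" using uF[OF t] shift[of j t] by (simp add: t_def)
    finally show "f n x = F (real n * x)" .
  next
    obtain w where "q_oscillation q (real n * pi_q q) (f n) w"
      using q_sine_oscillation[OF q n f[OF n]] by blast
    then show "square_integrable (f n)"
      by (intro square_integrable_continuous q_oscillation.continuous_on_v)
    show "square_integrable (\<lambda>x. F (real n * x))"
      by (intro square_integrable_continuous continuous_on_compose2[OF cF[of UNIV]] continuous_intros) auto
  qed
  with dilated bound show ?thesis by (intro that[of a]) simp_all
qed

section \<open>The remainder estimate\<close>

text \<open>The sums are exchanged for finitely many k only, and the bound, uniform in m, passes to
  the limit. A one-sided estimate suffices because it will be applied to a squared norm.\<close>

lemma expansion_tail_bound: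
  fixes e \<phi> :: "nat \<Rightarrow> 'a::real_inner"
  assumes on: "\<And>i j. i \<ge> 1 \<Longrightarrow> j \<ge> 1 \<Longrightarrow> inner (e i) (e j) = (if i = j then 1 else 0)"
    and a: "\<And>m. (\<Sum>k=1..m. \<bar>a k\<bar>) \<le> C"
    and \<phi>: "\<And>n. n \<ge> 1 \<Longrightarrow> (\<lambda>m. \<Sum>k=1..m. a k *\<^sub>R e (k * n)) \<longlonglongrightarrow> \<phi> n"
  shows "(\<Sum>n=N+1..M. inner h (e n) * inner g (\<phi> n))
    \<le> C * norm h * norm (g - (\<Sum>n=1..N. inner g (e n) *\<^sub>R e n))"
proof -
  define G where "G = g - (\<Sum>n=1..N. inner g (e n) *\<^sub>R e n)"
  have G: "inner g (e n) = inner G (e n)" if "n > N" for n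
  proof -
    have "(\<Sum>i=1..N. inner g (e i) * inner (e i) (e n)) = 0"
      using that on by (intro sum.neutral) auto
    then show ?thesis by (simp add: G_def inner_diff_left inner_sum_left)
  qed
  have tail: "\<bar>\<Sum>n=N+1..M. inner h (e n) * inner g (e (k * n))\<bar> \<le> norm h * norm G" if "k \<ge> 1" for k
  proof -
    \<comment> \<open>This is where dilation respects the cut at N: the coefficients of g met here
      agree with those of G.\<close>
    have kn: "k * n > N" if "n \<in> {N+1..M}" for n
      using that \<open>k \<ge> 1\<close> by (intro order_less_le_trans[of N n "k * n"]) auto
    have "(\<Sum>n=N+1..M. inner h (e n) * inner g (e (k * n)))\<^sup>2 =
        (\<Sum>n=N+1..M. inner h (e n) * inner G (e (k * n)))\<^sup>2"
      using G[OF kn] by (intro arg_cong[where f = "\<lambda>x. x\<^sup>2"] sum.cong) auto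
    also have "\<dots> \<le> (\<Sum>n=N+1..M. (inner h (e n))\<^sup>2) * (\<Sum>n=N+1..M. (inner G (e (k * n)))\<^sup>2)"
      by (rule Cauchy_Schwarz_ineq_sum)
    also have "\<dots> \<le> (norm h)\<^sup>2 * (norm G)\<^sup>2"
    proof (rule mult_mono)
      show "(\<Sum>n=N+1..M. (inner h (e n))\<^sup>2) \<le> (norm h)\<^sup>2"
        using on by (intro Bessel_inequality) auto
      show "(\<Sum>n=N+1..M. (inner G (e (k * n)))\<^sup>2) \<le> (norm G)\<^sup>2"
        using on \<open>k \<ge> 1\<close> by (intro Bessel_inequality) auto
    qed (auto intro: sum_nonneg)
    finally show ?thesis
      by (simp only: power_mult_distrib[symmetric] abs_le_square_iff[symmetric] abs_mult abs_norm_cancel)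
  qed
  have "(\<lambda>m. \<Sum>n=N+1..M. inner h (e n) * inner g (\<Sum>k=1..m. a k *\<^sub>R e (k * n)))
      \<longlonglongrightarrow> (\<Sum>n=N+1..M. inner h (e n) * inner g (\<phi> n))"
    by (intro tendsto_intros \<phi>) auto
  moreover have "(\<Sum>n=N+1..M. inner h (e n) * inner g (\<Sum>k=1..m. a k *\<^sub>R e (k * n))) \<le> C * norm h * norm G" for m
  proof -
    have "(\<Sum>n=N+1..M. inner h (e n) * inner g (\<Sum>k=1..m. a k *\<^sub>R e (k * n))) =
        (\<Sum>n=N+1..M. \<Sum>k=1..m. a k * (inner h (e n) * inner g (e (k * n))))"
      by (simp add: inner_sum_right sum_distrib_left mult_ac)
    also have "\<dots> = (\<Sum>k=1..m. a k * (\<Sum>n=N+1..M. inner h (e n) * inner g (e (k * n))))"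
      by (subst sum.swap) (simp add: sum_distrib_left)
    also have "\<dots> \<le> (\<Sum>k=1..m. \<bar>a k\<bar> * (norm h * norm G))"
    proof (rule sum_mono)
      fix k assume "k \<in> {1..m}"
      then have "\<bar>a k\<bar> * \<bar>\<Sum>n=N+1..M. inner h (e n) * inner g (e (k * n))\<bar> \<le> \<bar>a k\<bar> * (norm h * norm G)"
        by (intro mult_left_mono tail) auto
      then show "a k * (\<Sum>n=N+1..M. inner h (e n) * inner g (e (k * n))) \<le> \<bar>a k\<bar> * (norm h * norm G)"
        by (simp only: abs_mult[symmetric] order_trans[OF abs_ge_self])
    qed
    also have "\<dots> = (\<Sum>k=1..m. \<bar>a k\<bar>) * (norm h * norm G)" by (simp add: sum_distrib_right)
    also have "\<dots> \<le> C * (norm h * norm G)" by (intro mult_right_mono a) auto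
    finally show ?thesis by (simp add: mult.assoc)
  qed
  ultimately show ?thesis
    unfolding G_def[symmetric] by (intro LIMSEQ_le_const2) auto
qed

theorem lemma2:
  fixes q :: real and N :: nat and g :: L2
    and f :: "nat \<Rightarrow> real \<Rightarrow> real" and T :: "L2 \<Rightarrow> L2" and fstar :: "nat \<Rightarrow> L2"
  assumes "q \<ge> 12 / 11"
    and "N \<ge> 1"
    and q_sines: "\<And>n. n \<ge> 1 \<Longrightarrow> q_sine q n (f n)"
    and Schauder_transform: "bounded_linear T" "\<And>n. n \<ge> 1 \<Longrightarrow> T (sine_basis n) = to_L2 (f n)"
    and invertible: "bij T" "bounded_linear (inv T)"
    and dual: "\<And>j k. j \<ge> 1 \<Longrightarrow> k \<ge> 1 \<Longrightarrow> inner (to_L2 (f j)) (fstar k) = (if j = k then 1 else 0)"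
  shows "norm (g - (\<Sum>j=1..N. inner g (to_L2 (f j)) *\<^sub>R fstar j))
    \<le> onorm (inv T) * pi_q q / (2 * sqrt 2) *
      norm (g - (\<Sum>n=1..N. inner g (sine_basis n) *\<^sub>R sine_basis n))"
proof -
  have q: "q > 1" using assms(1) by linarith
  define C where "C = pi_q q / (2 * sqrt 2)"
  obtain a where a: "\<And>m. (\<Sum>k=1..m. \<bar>a k\<bar>) \<le> C"
    "\<And>n. n \<ge> 1 \<Longrightarrow> (\<lambda>m. \<Sum>k=1..m. a k *\<^sub>R sine_basis (k * n)) \<longlonglongrightarrow> to_L2 (f n)"
    unfolding C_def using q_sine_expansion[OF q q_sines] by blast
  define R where "R = g - (\<Sum>j=1..N. inner g (to_L2 (f j)) *\<^sub>R fstar j)"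
  define G where "G = g - (\<Sum>n=1..N. inner g (sine_basis n) *\<^sub>R sine_basis n)"
  define h where "h = inv T R"
  have Th: "T h = R" unfolding h_def using invertible(1) by (simp add: bij_is_surj surj_f_inv_f)
  \<comment> \<open>By biorthogonality the dual expansion reproduces the first N inner products of g
    and is orthogonal to every later f n.\<close>
  have R: "inner R (to_L2 (f n)) = (if n \<le> N then 0 else inner g (to_L2 (f n)))" if "n \<ge> 1" for n
  proof -
    have "(\<Sum>j=1..N. inner g (to_L2 (f j)) * inner (fstar j) (to_L2 (f n))) =
        (\<Sum>j=1..N. if j = n then inner g (to_L2 (f n)) else 0)"
      using dual that by (intro sum.cong) (auto simp: inner_commute)
    then show ?thesis using that by (simp add: R_def inner_diff_left inner_sum_left)
  qed
  \<comment> \<open>Continuity of T reduces the claim to finite sums, on which T is known by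
    linearity.\<close>
  have "(\<lambda>M. inner R (T (\<Sum>n=1..M. inner h (sine_basis n) *\<^sub>R sine_basis n))) \<longlonglongrightarrow> inner R (T h)"
    by (intro tendsto_inner tendsto_const bounded_linear.tendsto[OF Schauder_transform(1)]
        orthonormal_expansion_tendsto inner_sine_basis closure_sine_span)
  moreover have "inner R (T (\<Sum>n=1..M. inner h (sine_basis n) *\<^sub>R sine_basis n)) \<le> C * norm h * norm G" for M
  proof -
    interpret T: bounded_linear T by (rule Schauder_transform(1))
    have "inner R (T (\<Sum>n=1..M. inner h (sine_basis n) *\<^sub>R sine_basis n)) =
        (\<Sum>n=1..M. inner h (sine_basis n) * inner R (to_L2 (f n)))"
      using Schauder_transform(2) by (simp add: T.sum T.scaleR inner_sum_right)
    also have "\<dots> = (\<Sum>n=N+1..M. inner h (sine_basis n) * inner g (to_L2 (f n)))"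
      by (rule sum.mono_neutral_cong_right) (auto simp: R)
    also have "\<dots> \<le> C * norm h * norm G"
      unfolding G_def by (rule expansion_tail_bound[OF inner_sine_basis a])
    finally show ?thesis .
  qed
  ultimately have "inner R (T h) \<le> C * norm h * norm G"
    by (intro LIMSEQ_le_const2) auto
  then have "norm R * norm R \<le> C * norm h * norm G"
    by (simp add: Th norm_eq_sqrt_inner)
  also have "\<dots> \<le> C * (onorm (inv T) * norm R) * norm G"
  proof -
    have "norm h \<le> onorm (inv T) * norm R" unfolding h_def by (rule onorm[OF invertible(2)])
    moreover have "C \<ge> 0" using pi_q_pos[OF q] by (simp add: C_def)
    ultimately show ?thesis by (intro mult_left_mono mult_right_mono) auto
  qed
  finally have "norm R * norm R \<le> norm R * (onorm (inv T) * C * norm G)" by (simp add: mult_ac)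
  moreover have "0 \<le> onorm (inv T) * C * norm G"
    using onorm_pos_le[OF invertible(2)] pi_q_pos[OF q] by (simp add: C_def)
  \<comment> \<open>One factor \<open>norm R\<close> is cancelled; if it is 0, the bound holds
    because the right-hand side is nonnegative.\<close>
  ultimately have "norm R \<le> onorm (inv T) * C * norm G"
    by (cases "norm R = 0") (simp_all only: mult_le_cancel_left_pos zero_less_norm_iff norm_eq_zero, simp_all)
  then show ?thesis unfolding R_def G_def C_def by simp
qed

end
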